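(* Suppose $\mu_i=\mu$ for all $i\in\mathcal I$ and $\theta^*<1$. For $x\in\mathcal X$, write $\rho_i(x):=a_i(x)/\mu$. Let $\theta_1,\dots,\theta_m$, $S_1,\dots,S_m$ be the levels and blocks of the water-filling decomposition and $\rho^\ast$ the water-filling workload vector. Then: (1) The water-filling levels satisfy $1>\theta_1>\theta_2>\dots>\theta_m$, where $\theta_1=\theta^*$ and $S_1$ is the maximal bottleneck server set (the union of all $S\subseteq\mathcal I$ with $D(S)=\theta^*M(S)$); and $\rho^\ast$ is attainable by a stable state-independent randomized policy. (2) $\rho^\ast$ is the unique minimizer of the workload variance $\frac1I\sum_{i}\big(\rho_i-\frac1I\sum_j\rho_j\big)^2$, equivalently of the workload standard deviation $\mathrm{sd}(\rho)$ (its square root), over the attainable region $\mathcal R_{\mathrm{st}}$. In particular, $\min_{\eta\in\mathcal H_{\mathrm{st}}}\mathrm{sd}(\rho^\eta)=\mathrm{sd}(\rho^\ast)$, and the minimum is attained by a state-independent randomized policy. (3) A flow $x\in\mathcal X$ attains $\rho^\ast$ (i.e. $\rho_i(x)=\rho^\ast_i$ for all $i\in\mathcal I$) if and only if every overlapping region routes only to its least-loaded eligible servers, i.e. $$x_{ei}>0\ \Longrightarrow\ \rho_i(x)=\min_{j\in e}\rho_j(x)\qquad\text{for all } e\in\mathcal E,\ i\in e.$$ Any such flow induces a balance-optimal policy, i.e. the state-independent policy $\bar\eta_e(i)=x_{ei}/\lambda_e$ (with $\bar\eta_e$ an arbitrary probability distribution on $e$ when $\lambda_e=0$) is stable and attains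 the minimum in (2).
   Context: System. $\mathcal I=\{1,\dots,I\}$ is a finite nonempty set of servers. $\mathcal E$ is a finite set of nonempty subsets of $\mathcal I$ (hyperedges), with $e\not\subseteq e'$ for distinct $e,e'\in\mathcal E$; each $e$ represents an overlapping service region whose calls may be served by any server in $e$. Each server $i$ also has a primary region whose calls can be served only by $i$. Calls arrive by independent Poisson processes with rates $\lambda_i\ge 0$ (primary region of $i$) and $\lambda_e\ge 0$ (overlapping region $e$). Server $i$ has exponential service times with rate $\mu_i>0$ and its own infinite-capacity queue. Dispatch policies and the Markov chain. States are vectors $B=(n_i)_{i\in\mathcal I}\in\mathbb Z_+^I$, where $n_i$ is the number of calls at server $i$ (in service plus waiting). States are enumerated as $B_u$, $u\in\mathcal U=\{0,1,2,\dots\}$, by a fixed bijection. A Markovian dispatch policy is a family $\eta=\{\eta_{e,u}: e\in\mathcal E,u\in\mathcal U\}$ where $\eta_{e,u}$ is a probability distribution on $\mathcal I$ supported on $e$; $\eta_{e,u}(i)$ is the probability that a call from region $e$ arriving in state $B_u$ is assigned to server $i$. The policy is state-independent if $\eta_{e,u}$ does not depend on $u$. Under $\eta$ the system is the continuous-time Markov chain (CTMC) on $\mathbb Z_+^I$ with transition rates (where $\mathbf e_i$ is the $i$-th unit vector): from $B_u$ to $B_u+\mathbf e_i$ at rate $\lambda_i+\sum_{e\in\mathcal E}\eta_{e,u}(i)\lambda_e$, and from $B_u$ to $B_u-\mathbf e_i$ at rate $\mu_i$ if $(B_u)_i>0$; no other transitions. $\mathcal H_{\mathrm{st}}$ is the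 set of Markovian dispatch policies under which this CTMC is positive recurrent ("stable"), in the sense that it admits a stationary probability distribution (unique, since the all-zero state is reachable from every state), denoted $\pi^\eta$. For $\eta\in\mathcal H_{\mathrm{st}}$ the workload of server $i$ is $\rho_i^\eta:=\sum_{u\in\mathcal U}\mathbf 1\{(B_u)_i>0\}\pi_u^\eta$, and the attainable region is $\mathcal R_{\mathrm{st}}:=\{(\rho_i^\eta)_{i\in\mathcal I}:\eta\in\mathcal H_{\mathrm{st}}\}$. A workload vector is attainable by a policy $\eta$ if it equals $\rho^\eta$. Flows, demand, capacity. The hyperedge-flow polytope is $$\mathcal X:=\Big\{x=(x_{ei})_{e\in\mathcal E,\,i\in e}:\ x_{ei}\ge 0,\ \sum_{i\in e}x_{ei}=\lambda_e\ \ \forall e\in\mathcal E\Big\},$$ and for $x\in\mathcal X$, $a_i(x):=\lambda_i+\sum_{e\in\mathcal E:\,i\in e}x_{ei}$. For $S\subseteq\mathcal I$, $D(S):=\sum_{i\in S}\lambda_i+\sum_{e\in\mathcal E:\,e\subseteq S}\lambda_e$ and $M(S):=\sum_{i\in S}\mu_i$. The minimum achievable peak workload is $\theta^*:=\min_{x\in\mathcal X}\max_{i\in\mathcal I}a_i(x)/\mu_i$. Water-filling decomposition. Put $U_1:=\mathcal I$, $D_1:=D$. For $k=1,2,\dots$, as long as $U_k\ne\varnothing$, let $$\theta_k:=\max_{\varnothing\ne S\subseteq U_k}\frac{D_k(S)}{M(S)},$$ let $S_k$ be the maximal bottleneck set of $(U_k,D_k)$, i.e. the largest (with respect to inclusion)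 set $S\subseteq U_k$ with $D_k(S)=\theta_kM(S)$ (the collection of such sets is closed under union, so $S_k$ is their union), and set $U_{k+1}:=U_k\setminus S_k$ and $D_{k+1}(S):=D_k(S\cup S_k)-D_k(S_k)$ for $S\subseteq U_{k+1}$. The recursion terminates after $m\le I$ steps with a partition $\mathcal I=S_1\cup\dots\cup S_m$. The water-filling workload vector $\rho^\ast$ is defined by $\rho^\ast_i:=\theta_k$ for $i\in S_k$. *)

theory Defs
  imports "HOL-Probability.Probability"
begin

section \<open>Service systems with overlapping regions\<close>

text \<open>
  The set of servers is the universe of a finite type \<open>'i\<close>. States are vectors of queue lengths,
  of type \<open>'i \<Rightarrow> nat\<close>; \<open>state_enum\<close> is the fixed bijective enumeration \<open>u \<mapsto> B\<^sub>u\<close>.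
\<close>

record 'i dispatch_system =
  hyperedges :: "'i set set"
  primary_rate :: "'i \<Rightarrow> real"
  overlap_rate :: "'i set \<Rightarrow> real"
  service_rate :: "'i \<Rightarrow> real"
  state_enum :: "nat \<Rightarrow> 'i \<Rightarrow> nat"

definition valid_system :: "'i::finite dispatch_system \<Rightarrow> bool" where
  "valid_system G \<longleftrightarrow>
     {} \<notin> hyperedges G \<and>
     (\<forall>e\<in>hyperedges G. \<forall>e'\<in>hyperedges G. e \<noteq> e' \<longrightarrow> \<not> e \<subseteq> e') \<and>
     (\<forall>i. 0 \<le> primary_rate G i) \<and>
     (\<forall>e\<in>hyperedges G. 0 \<le> overlap_rate G e) \<and>
     (\<forall>i. 0 < service_rate G i) \<and>
     bij (state_enum G)"


section \<open>Dispatch policies and the Markov chain\<close>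

text \<open>
  \<open>\<eta> e u\<close> is the distribution of the server assigned to a call from region \<open>e\<close> arriving in state
  \<open>B\<^sub>u\<close>. Its values for \<open>e\<close> outside the set of hyperedges are irrelevant.
\<close>

type_synonym 'i policy = "'i set \<Rightarrow> nat \<Rightarrow> 'i pmf"

definition markov_policy :: "'i::finite dispatch_system \<Rightarrow> 'i policy \<Rightarrow> bool" where
  "markov_policy G \<eta> \<longleftrightarrow> (\<forall>e\<in>hyperedges G. \<forall>u. set_pmf (\<eta> e u) \<subseteq> e)"

definition state_independent :: "'i::finite dispatch_system \<Rightarrow> 'i policy \<Rightarrow> bool" where
  "state_independent G \<eta> \<longleftrightarrow> (\<forall>e\<in>hyperedges G. \<forall>u v. \<eta> e u = \<eta> e v)"

definition arrival_rate :: "'i::finite dispatch_system \<Rightarrow> 'i policy \<Rightarrow> nat \<Rightarrow> 'i \<Rightarrow> real" where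
  "arrival_rate G \<eta> u i =
     primary_rate G i + (\<Sum>e\<in>hyperedges G. pmf (\<eta> e u) i * overlap_rate G e)"

text \<open>
  For fixed \<open>u\<close> and \<open>v\<close> at most one summand below is nonzero.
\<close>

definition transition_rate :: "'i::finite dispatch_system \<Rightarrow> 'i policy \<Rightarrow> nat \<Rightarrow> nat \<Rightarrow> real" where
  "transition_rate G \<eta> u v =
     (let B = state_enum G in
       (\<Sum>i\<in>UNIV. if B v = (B u)(i := B u i + 1) then arrival_rate G \<eta> u i else 0) +
       (\<Sum>i\<in>UNIV. if B u i > 0 \<and> B v = (B u)(i := B u i - 1) then service_rate G i else 0))"

text \<open>
  A probability distribution \<open>\<pi>\<close> is stationary for the chain with jump rates \<open>q\<close> (where
  \<open>q u u = 0\<close>) if \<open>\<pi> Q = 0\<close> for the generator \<open>Q\<close>: at each state the probability flux in equals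
  the flux out. In the chains considered here jump rates are bounded and each state has finitely
  many neighbours, so the chain is non-explosive and all sums have finite support.
\<close>

definition stationary :: "(nat \<Rightarrow> nat \<Rightarrow> real) \<Rightarrow> nat pmf \<Rightarrow> bool" where
  "stationary q \<pi> \<longleftrightarrow>
     (\<forall>v. ((\<lambda>u. pmf \<pi> u * q u v) has_sum (pmf \<pi> v * (\<Sum>\<^sub>\<infinity>w. q v w))) UNIV)"

definition stable_policies :: "'i::finite dispatch_system \<Rightarrow> 'i policy set" where
  "stable_policies G = {\<eta>. markov_policy G \<eta> \<and> (\<exists>\<pi>. stationary (transition_rate G \<eta>) \<pi>)}"

definition stationary_dist :: "'i::finite dispatch_system \<Rightarrow> 'i policy \<Rightarrow> nat pmf" where
  "stationary_dist G \<eta> = (THE \<pi>. stationary (transition_rate G \<eta>) \<pi>)"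

definition workload :: "'i::finite dispatch_system \<Rightarrow> 'i policy \<Rightarrow> 'i \<Rightarrow> real" where
  "workload G \<eta> i = measure_pmf.prob (stationary_dist G \<eta>) {u. state_enum G u i > 0}"

definition attainable_region :: "'i::finite dispatch_system \<Rightarrow> ('i \<Rightarrow> real) set" where
  "attainable_region G = workload G ` stable_policies G"


section \<open>Flows, demand and capacity\<close>

text \<open>
  Only the coordinates \<open>x e i\<close> with \<open>e\<close> a hyperedge and \<open>i \<in> e\<close> are meaningful.
\<close>

definition flows :: "'i::finite dispatch_system \<Rightarrow> ('i set \<Rightarrow> 'i \<Rightarrow> real) set" where
  "flows G = {x. \<forall>e\<in>hyperedges G. (\<forall>i\<in>e. 0 \<le> x e i) \<and> (\<Sum>i\<in>e. x e i) = overlap_rate G e}"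

definition inflow :: "'i::finite dispatch_system \<Rightarrow> ('i set \<Rightarrow> 'i \<Rightarrow> real) \<Rightarrow> 'i \<Rightarrow> real" where
  "inflow G x i = primary_rate G i + (\<Sum>e\<in>{e \<in> hyperedges G. i \<in> e}. x e i)"

definition flow_workload :: "'i::finite dispatch_system \<Rightarrow> ('i set \<Rightarrow> 'i \<Rightarrow> real) \<Rightarrow> 'i \<Rightarrow> real" where
  "flow_workload G x i = inflow G x i / service_rate G i"

definition demand :: "'i::finite dispatch_system \<Rightarrow> 'i set \<Rightarrow> real" where
  "demand G S =
     (\<Sum>i\<in>S. primary_rate G i) + (\<Sum>e\<in>{e \<in> hyperedges G. e \<subseteq> S}. overlap_rate G e)"

definition capacity :: "'i::finite dispatch_system \<Rightarrow> 'i set \<Rightarrow> real" where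
  "capacity G S = (\<Sum>i\<in>S. service_rate G i)"

definition min_peak_workload :: "'i::finite dispatch_system \<Rightarrow> real" where
  "min_peak_workload G =
     (LEAST t. t \<in> (\<lambda>x. Max (range (flow_workload G x))) ` flows G)"


section \<open>Water-filling decomposition\<close>

definition level :: "'i::finite dispatch_system \<Rightarrow> 'i set \<Rightarrow> ('i set \<Rightarrow> real) \<Rightarrow> real" where
  "level G U D = Max ((\<lambda>S. D S / capacity G S) ` {S. S \<noteq> {} \<and> S \<subseteq> U})"

text \<open>
  \<open>GREATEST\<close> refers to the inclusion order.
\<close>

definition bottleneck :: "'i::finite dispatch_system \<Rightarrow> 'i set \<Rightarrow> ('i set \<Rightarrow> real) \<Rightarrow> 'i set" where
  "bottleneck G U D = (GREATEST S. S \<subseteq> U \<and> D S = level G U D * capacity G S)"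

text \<open>
  Steps are counted from 0: \<open>wf_stage G k\<close> is the pair \<open>(U\<^sub>k\<^sub>+\<^sub>1, D\<^sub>k\<^sub>+\<^sub>1)\<close> of the usual numbering from 1,
  so the \<open>m = wf_steps G\<close> levels and blocks are \<open>wf_level G k\<close> and \<open>wf_block G k\<close> with \<open>k < m\<close>.
  Values for \<open>k \<ge> m\<close> (empty remaining set) carry no meaning.
\<close>

primrec wf_stage :: "'i::finite dispatch_system \<Rightarrow> nat \<Rightarrow> 'i set \<times> ('i set \<Rightarrow> real)" where
  "wf_stage G 0 = (UNIV, demand G)"
| "wf_stage G (Suc k) =
     (let (U, D) = wf_stage G k; S = bottleneck G U D
      in (U - S, \<lambda>T. D (T \<union> S) - D S))"

definition wf_level :: "'i::finite dispatch_system \<Rightarrow> nat \<Rightarrow> real" where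
  "wf_level G k = (let (U, D) = wf_stage G k in level G U D)"

definition wf_block :: "'i::finite dispatch_system \<Rightarrow> nat \<Rightarrow> 'i set" where
  "wf_block G k = (let (U, D) = wf_stage G k in bottleneck G U D)"

definition wf_steps :: "'i::finite dispatch_system \<Rightarrow> nat" where
  "wf_steps G = (LEAST k. fst (wf_stage G k) = {})"

definition wf_workload :: "'i::finite dispatch_system \<Rightarrow> 'i \<Rightarrow> real" where
  "wf_workload G i = wf_level G (THE k. k < wf_steps G \<and> i \<in> wf_block G k)"


section \<open>Workload variance\<close>

definition workload_mean :: "('i::finite \<Rightarrow> real) \<Rightarrow> real" where
  "workload_mean \<rho> = (\<Sum>i\<in>UNIV. \<rho> i) / real CARD('i)"

definition workload_var :: "('i::finite \<Rightarrow> real) \<Rightarrow> real" where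
  "workload_var \<rho> = (\<Sum>i\<in>UNIV. (\<rho> i - workload_mean \<rho>)\<^sup>2) / real CARD('i)"

definition workload_sd :: "('i::finite \<Rightarrow> real) \<Rightarrow> real" where
  "workload_sd \<rho> = sqrt (workload_var \<rho>)"

definition balance_optimal :: "'i::finite dispatch_system \<Rightarrow> 'i policy \<Rightarrow> bool" where
  "balance_optimal G \<eta> \<longleftrightarrow>
     is_arg_min (\<lambda>\<eta>'. workload_sd (workload G \<eta>')) (\<lambda>\<eta>'. \<eta>' \<in> stable_policies G) \<eta>"

text \<open>
  The policies induced by a flow \<open>x\<close>; for regions of rate 0 the distribution is arbitrary.
\<close>

definition induced_policy ::
  "'i::finite dispatch_system \<Rightarrow> ('i set \<Rightarrow> 'i \<Rightarrow> real) \<Rightarrow> 'i policy \<Rightarrow> bool" where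
  "induced_policy G x \<eta> \<longleftrightarrow>
     markov_policy G \<eta> \<and> state_independent G \<eta> \<and>
     (\<forall>e\<in>hyperedges G. overlap_rate G e \<noteq> 0 \<longrightarrow>
        (\<forall>u. \<forall>i\<in>e. pmf (\<eta> e u) i = x e i / overlap_rate G e))"

end

theory Submission
  imports Defs
begin

text \<open>
  Testing stationarity against \<open>min n\<^sub>i K\<close> and letting \<open>K\<close> grow shows that a stable policy serves at
  server \<open>i\<close> exactly what it sends there, so its workload vector is the workload vector of a flow.
  Conversely a flow with all workloads below 1 induces a state-independent policy whose stationary
  law is a product of geometric distributions. The problem thus reduces to flows.

  By convexity, the flows minimizing \<open>\<Sum>\<^sub>i a\<^sub>i(x)\<^sup>2/\<mu>\<^sub>i\<close> are those sending work only to the least loaded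
  servers of each region, and they share one workload vector. Under such a flow an upper level set
  \<open>T\<close> of the workloads receives nothing from a region not contained in \<open>T\<close>, so the general bound
  \<open>D(S) \<le> \<Sum>\<^bsub>i\<in>S\<^esub> a\<^sub>i(x)\<close> is an equality for \<open>S = T\<close>, and the water-filling recursion peels off the
  level sets from the top. For equal service rates the total workload is fixed, so the minimized
  quantity is the variance up to an increasing affine map.
\<close>

section \<open>Stationary distributions for bounded jump rates\<close>

lemma has_sum_minus:
  fixes f g :: "'a \<Rightarrow> real"
  assumes "(f has_sum a) A" and "(g has_sum b) A"
  shows "((\<lambda>x. f x - g x) has_sum (a - b)) A"
  using has_sum_add[OF assms(1) has_sum_uminusI[OF assms(2)]] by simp

text \<open>A bounded function is absolutely summable against a probability mass function. This
  links the \<open>has_sum\<close> form used in \<open>stationary\<close> to integrals, where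
  dominated convergence is available.\<close>

lemma has_sum_pmf_expectation:
  fixes f :: "'a \<Rightarrow> real"
  assumes "\<And>u. \<bar>f u\<bar> \<le> C"
  shows "((\<lambda>u. pmf p u * f u) has_sum measure_pmf.expectation p f) UNIV"
proof -
  have "integrable (measure_pmf p) f"
    by (rule measure_pmf.integrable_const_bound[where B = C]) (use assms in auto)
  then have "integrable (count_space UNIV) (\<lambda>u. pmf p u * f u)"
    by (simp add: measure_pmf_eq_density integrable_density)
  then have "Infinite_Set_Sum.abs_summable_on (\<lambda>u. pmf p u * f u) UNIV"
    by (simp add: Infinite_Set_Sum.abs_summable_on_def)
  then have "(\<lambda>u. norm (pmf p u * f u)) summable_on UNIV"
    and "infsetsum (\<lambda>u. pmf p u * f u) UNIV = infsum (\<lambda>u. pmf p u * f u) UNIV"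
    by (rule abs_summable_equivalent[THEN iffD2], rule infsetsum_infsum)
  then show ?thesis
    by (simp add: pmf_expectation_eq_infsetsum abs_summable_summable has_sum_infsum)
qed

lemma has_sum_pmf: "(pmf p has_sum 1) UNIV"
  using has_sum_pmf_expectation[of "\<lambda>_. 1" 1 p] by simp

text \<open>Fubini for the family \<open>h u * q u v * f v\<close>: row sums at most
  \<open>C\<close> and \<open>f\<close> bounded by \<open>F\<close> make it absolutely summable, so
  summing by rows and summing by columns agree. For \<open>h\<close> a stationary law this moves the
  jump rates from the law to the test function \<open>f\<close>.\<close>

lemma has_sum_rates_swap:
  fixes q :: "'a \<Rightarrow> 'a \<Rightarrow> real"
  assumes q0: "\<And>u v. 0 \<le> q u v"
    and row: "\<And>u. (q u has_sum r u) UNIV" and C: "\<And>u. r u \<le> C"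
    and h: "(\<lambda>u. \<bar>h u\<bar>) summable_on UNIV" and F: "\<And>v. \<bar>f v\<bar> \<le> F"
    and rowf: "\<And>u. ((\<lambda>v. q u v * f v) has_sum g u) UNIV"
    and col: "\<And>v. ((\<lambda>u. h u * q u v) has_sum k v) UNIV"
    and tot: "((\<lambda>v. k v * f v) has_sum S) UNIV"
  shows "((\<lambda>u. h u * g u) has_sum S) UNIV"
proof -
  let ?j = "\<lambda>(u, v). h u * q u v * f v"
  have "(\<lambda>(u, v). \<bar>h u\<bar> * q u v * F) summable_on UNIV \<times> UNIV"
  proof (rule summable_on_SigmaI[where g = "\<lambda>u. \<bar>h u\<bar> * r u * F"])
    show "((\<lambda>v. case (u, v) of (u, v) \<Rightarrow> \<bar>h u\<bar> * q u v * F) has_sum \<bar>h u\<bar> * r u * F) UNIV" for u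
      using has_sum_cmult_right[OF row[of u], of "\<bar>h u\<bar> * F"] by (simp add: mult_ac)
    have r0: "0 \<le> r u" for u using has_sum_nonneg[OF row] q0 by blast
    \<comment> \<open>The bound at any single point already forces \<open>F\<close> to be
      nonnegative; \<open>undefined\<close> is just some point of the type.\<close>
    have F0: "0 \<le> F" using F[of undefined] by linarith
    show "(\<lambda>u. \<bar>h u\<bar> * r u * F) summable_on UNIV"
    proof (rule summable_on_comparison_test)
      show "(\<lambda>u. \<bar>h u\<bar> * (C * F)) summable_on UNIV" by (rule summable_on_cmult_left[OF h])
      show "\<bar>h u\<bar> * r u * F \<le> \<bar>h u\<bar> * (C * F)" for u
        using C[of u] F0 by (simp add: mult.assoc mult_left_mono mult_right_mono)
      show "0 \<le> \<bar>h u\<bar> * r u * F" for u using r0 F0 by simp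
    qed
    show "0 \<le> (case (u, v) of (u, v) \<Rightarrow> \<bar>h u\<bar> * q u v * F)" for u v using q0 F0 by simp
  qed
  then have "(\<lambda>x. norm (case x of (u, v) \<Rightarrow> \<bar>h u\<bar> * q u v * F)) summable_on UNIV \<times> UNIV"
    by (rule summable_on_iff_abs_summable_on_real[THEN iffD1])
  then have "(\<lambda>x. norm (?j x)) summable_on UNIV \<times> UNIV"
  proof (rule Infinite_Sum.abs_summable_on_comparison_test)
    fix x :: "'a \<times> 'a"
    show "norm (?j x) \<le> norm (case x of (u, v) \<Rightarrow> \<bar>h u\<bar> * q u v * F)"
      using F[of "snd x"] q0 by (auto simp: abs_mult case_prod_unfold intro!: mult_left_mono)
  qed
  then have "?j summable_on UNIV \<times> UNIV" by (rule abs_summable_summable)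
  then obtain T where T: "(?j has_sum T) (UNIV \<times> UNIV)" by (auto simp: summable_on_def)
  have "((\<lambda>u. h u * g u) has_sum T) UNIV"
  proof (rule has_sum_SigmaD[OF T])
    show "((\<lambda>v. case (u, v) of (u, v) \<Rightarrow> h u * q u v * f v) has_sum h u * g u) UNIV" for u
      using has_sum_cmult_right[OF rowf[of u], of "h u"] by (simp add: mult.assoc)
  qed
  moreover have "((\<lambda>v. k v * f v) has_sum T) UNIV"
    by (rule has_sum_SigmaD[OF T[THEN has_sum_swap[THEN iffD1]]])
      (use has_sum_cmult_left[OF col] in simp)
  ultimately show ?thesis using has_sum_unique[OF tot] by simp
qed

text \<open>
  The total variation of the difference of two stationary distributions is again invariant, hence so
  are its positive and negative parts; irreducible access to \<open>z\<close> forbids both of them to be nonzero.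
\<close>

lemma stationary_unique:
  fixes q :: "nat \<Rightarrow> nat \<Rightarrow> real"
  assumes q0: "\<And>u v. 0 \<le> q u v"
    and row: "\<And>u. (q u has_sum r u) UNIV" and C: "\<And>u. r u \<le> C"
    and reach: "\<And>u. (u, z) \<in> {(u, v). 0 < q u v}\<^sup>*"
    and p: "stationary q p" and p': "stationary q p'"
  shows "p = p'"
proof -
  have r0: "0 \<le> r u" for u using has_sum_nonneg[OF row] q0 by blast
  have rsum: "(\<Sum>\<^sub>\<infinity>w. q v w) = r v" for v using row infsumI by blast
  define s where "s u = pmf p u - pmf p' u" for u
  define t where "t u = \<bar>s u\<bar>" for u
  have s_sum: "(s has_sum 0) UNIV"
    using has_sum_minus[OF has_sum_pmf[of p] has_sum_pmf[of p']] by (simp add: s_def[abs_def])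
  then have t_abs: "(\<lambda>u. \<bar>t u\<bar>) summable_on UNIV"
    unfolding t_def using summable_on_iff_abs_summable_on_real[of s UNIV]
    by (auto simp: summable_on_def)
  have s_inv: "((\<lambda>u. s u * q u v) has_sum s v * r v) UNIV" for v
    using has_sum_minus[OF p[unfolded stationary_def, rule_format, of v]
        p'[unfolded stationary_def, rule_format, of v]]
    by (simp add: s_def rsum algebra_simps)
  have t_col: "\<exists>k. ((\<lambda>u. t u * q u v) has_sum k) UNIV" for v
    using s_inv[of v] summable_on_iff_abs_summable_on_real[of "\<lambda>u. s u * q u v" UNIV] q0
    by (auto simp: summable_on_def t_def abs_mult)
  then have "\<forall>v. \<exists>k. ((\<lambda>u. t u * q u v) has_sum k) UNIV" ..
  then obtain k where k: "((\<lambda>u. t u * q u v) has_sum k v) UNIV" for v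
    by (auto dest!: choice)
  \<comment> \<open>Triangle inequality applied to the invariance of \<open>s\<close>: its absolute
    value \<open>t\<close> is at least subinvariant.\<close>
  have ge: "t v * r v \<le> k v" for v
  proof -
    have le: "\<bar>s u * q u v\<bar> \<le> t u * q u v" for u by (simp add: t_def abs_mult q0)
    have "s v * r v \<le> k v" by (rule has_sum_mono[OF s_inv k]) (use le in \<open>simp add: abs_le_iff\<close>)
    moreover have "- (s v * r v) \<le> k v"
      by (rule has_sum_mono[OF has_sum_uminusI[OF s_inv] k]) (use le in \<open>simp add: abs_le_iff\<close>)
    ultimately show ?thesis by (auto simp: t_def abs_if)
  qed
  have "(\<lambda>u. t u * r u) summable_on UNIV"
  proof (rule summable_on_comparison_test)
    show "(\<lambda>u. \<bar>t u\<bar> * C) summable_on UNIV" by (rule summable_on_cmult_left[OF t_abs])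
  qed (use C r0 in \<open>auto simp: t_def intro!: mult_left_mono\<close>)
  then obtain T where T: "((\<lambda>u. t u * r u) has_sum T) UNIV" by (auto simp: summable_on_def)
  have "(\<lambda>v. k v) summable_on UNIV"
  proof -
    have "(\<lambda>(u, v). t u * q u v) summable_on UNIV \<times> UNIV"
      by (rule summable_on_SigmaI[where g = "\<lambda>u. t u * r u"])
        (use has_sum_cmult_right[OF row] T q0 in \<open>auto simp: summable_on_def t_def\<close>)
    then obtain W where W: "((\<lambda>(u, v). t u * q u v) has_sum W) (UNIV \<times> UNIV)"
      by (auto simp: summable_on_def)
    have "(k has_sum W) UNIV"
      by (rule has_sum_SigmaD[OF W[THEN has_sum_swap[THEN iffD1]]]) (use k in simp)
    then show ?thesis by (auto simp: summable_on_def)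
  qed
  then obtain W where W: "(k has_sum W) UNIV" by (auto simp: summable_on_def)
  \<comment> \<open>With the constant test function 1 the total inflow of \<open>t\<close> equals
    its total outflow. The nonnegative differences in \<open>ge\<close> therefore sum to 0, which
    makes \<open>t\<close> invariant.\<close>
  have "((\<lambda>u. t u * r u) has_sum W) UNIV"
    by (rule has_sum_rates_swap[OF q0 row C t_abs, where f = "\<lambda>_. 1" and F = 1 and k = k])
      (use row k W in auto)
  then have "((\<lambda>v. k v - t v * r v) has_sum 0) UNIV" using W has_sum_minus by fastforce
  then have "k v = t v * r v" for v using nonneg_has_sum_le_0D[of _ _ _ v] ge by fastforce
  then have t_inv: "((\<lambda>u. t u * q u v) has_sum t v * r v) UNIV" for v using k[of v] by simp
  \<comment> \<open>Positive mass of a nonnegative invariant \<open>w\<close> spreads along every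
    possible jump, because the outflow at \<open>y\<close> is at least the single inflow term from
    \<open>x\<close>.\<close>
  have invariant_pos: "0 < w z"
    if inv: "\<And>v. ((\<lambda>u. w u * q u v) has_sum w v * r v) UNIV"
      and w0: "\<And>v. 0 \<le> w v" and pos: "0 < w u" for w u
  proof -
    from reach[of u] show ?thesis
    proof (induction rule: rtrancl_induct)
      case (step x y)
      have "w x * q x y \<le> w y * r y"
        using has_sum_mono2[OF has_sum_finite inv[of y], of "{x}"] w0 q0 by auto
      moreover have "0 < w x * q x y" using step by simp
      ultimately have "0 < w y * r y" by linarith
      then show ?case using w0[of y] r0[of y] by (simp add: zero_less_mult_iff)
    qed (rule pos)
  qed
  \<comment> \<open>The functions \<open>t - s\<close> and \<open>t + s\<close> are twice the
    negative and the positive part of \<open>s\<close>; one of them vanishes at \<open>z\<close>,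
    hence everywhere. Then \<open>s\<close> has constant sign, and its sum 0 leaves only
    \<open>s = 0\<close>.\<close>
  have "s u = 0" for u
  proof (cases "0 < s z")
    case True
    have "((\<lambda>u. (t u - s u) * q u v) has_sum (t v - s v) * r v) UNIV" for v
      using has_sum_minus[OF t_inv[of v] s_inv[of v]] by (simp add: left_diff_distrib)
    from invariant_pos[OF this] have "\<not> 0 < t v - s v" for v
      using True by (fastforce simp: t_def)
    then have "0 \<le> s v" for v by (smt (verit) t_def)
    then show ?thesis using nonneg_has_sum_le_0D[OF s_sum, of u] by auto
  next
    case False
    have "((\<lambda>u. (t u + s u) * q u v) has_sum (t v + s v) * r v) UNIV" for v
      using has_sum_add[OF t_inv[of v] s_inv[of v]] by (simp add: distrib_right)
    from invariant_pos[OF this] have "\<not> 0 < t v + s v" for v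
      using False by (fastforce simp: t_def)
    then have "0 \<le> - s v" for v by (smt (verit) t_def)
    then show ?thesis using nonneg_has_sum_le_0D[OF has_sum_uminusI[OF s_sum], of u] by auto
  qed
  then show ?thesis by (intro pmf_eqI) (simp add: s_def)
qed

section \<open>Rate balance\<close>

definition up :: "'i::finite dispatch_system \<Rightarrow> nat \<Rightarrow> 'i \<Rightarrow> nat" where
  "up G u i = inv (state_enum G) ((state_enum G u)(i := state_enum G u i + 1))"

text \<open>At an empty server truncated subtraction gives \<open>down G u i = u\<close>; the rates
  attached to that spurious neighbour are always set to 0.\<close>

definition down :: "'i::finite dispatch_system \<Rightarrow> nat \<Rightarrow> 'i \<Rightarrow> nat" where
  "down G u i = inv (state_enum G) ((state_enum G u)(i := state_enum G u i - 1))"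

definition exit_rate :: "'i::finite dispatch_system \<Rightarrow> 'i policy \<Rightarrow> nat \<Rightarrow> real" where
  "exit_rate G \<eta> u = (\<Sum>i\<in>UNIV. arrival_rate G \<eta> u i) +
     (\<Sum>i\<in>UNIV. if 0 < state_enum G u i then service_rate G i else 0)"

lemma has_sum_if_eq:
  fixes a :: "'b :: {topological_comm_monoid_add, t2_space}"
  shows "((\<lambda>v. if v = c then a else 0) has_sum a) UNIV"
  by (rule has_sum_finite_neutralI[where B = "{c}"]) auto

lemma has_sum_finite_sum:
  fixes f :: "'i \<Rightarrow> 'a \<Rightarrow> 'b :: {topological_comm_monoid_add, t2_space}"
  assumes "finite I" and "\<And>i. i \<in> I \<Longrightarrow> (f i has_sum s i) A"
  shows "((\<lambda>x. \<Sum>i\<in>I. f i x) has_sum (\<Sum>i\<in>I. s i)) A"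
  using assms by (induction rule: finite_induct) (auto intro: has_sum_add)

context
  fixes G :: "'i::finite dispatch_system"
  assumes valid: "valid_system G"
begin

lemma primary_rate_nonneg: "0 \<le> primary_rate G i"
  and overlap_rate_nonneg: "e \<in> hyperedges G \<Longrightarrow> 0 \<le> overlap_rate G e"
  and service_rate_pos: "0 < service_rate G i"
  and hyperedge_nonempty: "e \<in> hyperedges G \<Longrightarrow> e \<noteq> {}"
  and bij_state_enum: "bij (state_enum G)"
  using valid by (auto simp: valid_system_def)

lemma state_enum_inv [simp]: "state_enum G (inv (state_enum G) b) = b"
  using bij_state_enum by (simp add: bij_is_surj surj_f_inv_f)

lemma inv_state_enum [simp]: "inv (state_enum G) (state_enum G u) = u"
  using bij_state_enum by (simp add: bij_is_inj)

lemma state_enum_up [simp]: "state_enum G (up G u i) = (state_enum G u)(i := Suc (state_enum G u i))"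
  by (simp add: up_def)

lemma state_enum_down [simp]:
  "state_enum G (down G u i) = (state_enum G u)(i := state_enum G u i - Suc 0)"
  by (simp add: down_def)

lemma state_enum_eq_iff: "state_enum G u = state_enum G v \<longleftrightarrow> u = v"
  by (metis inv_state_enum)

lemma eq_up_state:
  "v = up G u i \<longleftrightarrow> state_enum G v = (state_enum G u)(i := state_enum G u i + 1)"
  using state_enum_eq_iff[of v "up G u i"] by simp

lemma eq_down_state:
  "v = down G u i \<longleftrightarrow> state_enum G v = (state_enum G u)(i := state_enum G u i - 1)"
  using state_enum_eq_iff[of v "down G u i"] by simp

lemma transition_rate_eq:
  "transition_rate G \<eta> u v =
     (\<Sum>i\<in>UNIV. if v = up G u i then arrival_rate G \<eta> u i else 0) +
     (\<Sum>i\<in>UNIV. if v = down G u i then (if 0 < state_enum G u i then service_rate G i else 0) else 0)"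
  unfolding transition_rate_def Let_def
  by (intro arg_cong2[where f = "(+)"] sum.cong refl)
    (simp_all add: eq_up_state eq_down_state)

text \<open>Arrivals and departures are mutually inverse moves; this turns a sum over targets of a
  jump into a sum over its sources.\<close>

lemma eq_up_iff: "v = up G u i \<longleftrightarrow> 0 < state_enum G v i \<and> u = down G v i"
  unfolding eq_up_state eq_down_state by (auto simp: fun_eq_iff split: if_splits)

text \<open>The same rate read from the target: for fixed \<open>v\<close> the sources are the
  neighbours of \<open>v\<close>, so the columns needed for stationarity become finite sums.\<close>

lemma transition_rate_eq':
  "transition_rate G \<eta> u v =
     (\<Sum>i\<in>UNIV. if u = down G v i then
        (if 0 < state_enum G v i then arrival_rate G \<eta> u i else 0) else 0) +
     (\<Sum>i\<in>UNIV. if u = up G v i then service_rate G i else 0)"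
  unfolding transition_rate_eq
proof (intro arg_cong2[where f = "(+)"] sum.cong refl)
  fix i
  show "(if v = up G u i then arrival_rate G \<eta> u i else 0) =
      (if u = down G v i then (if 0 < state_enum G v i then arrival_rate G \<eta> u i else 0) else 0)"
    using eq_up_iff[of v u i] by metis
  show "(if v = down G u i then (if 0 < state_enum G u i then service_rate G i else 0) else 0) =
      (if u = up G v i then service_rate G i else 0)"
    using eq_up_iff[of u v i] by metis
qed

text \<open>Every summand of the rate is supported on one state, so the infinite sum splits into
  finitely many one-point sums, whether or not neighbours coincide. Taking \<open>f\<close> constant
  gives the exit rate; taking \<open>f\<close> a truncated queue length gives the rate
  balance.\<close>

lemma transition_row:
  "((\<lambda>v. transition_rate G \<eta> u v * f v) has_sum
     (\<Sum>i\<in>UNIV. arrival_rate G \<eta> u i * f (up G u i)) +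
     (\<Sum>i\<in>UNIV. (if 0 < state_enum G u i then service_rate G i else 0) * f (down G u i))) UNIV"
proof -
  have "((\<lambda>v. (\<Sum>i\<in>UNIV. if v = up G u i then arrival_rate G \<eta> u i * f (up G u i) else 0) +
     (\<Sum>i\<in>UNIV. if v = down G u i
        then (if 0 < state_enum G u i then service_rate G i else 0) * f (down G u i) else 0)) has_sum
     (\<Sum>i\<in>UNIV. arrival_rate G \<eta> u i * f (up G u i)) +
     (\<Sum>i\<in>UNIV. (if 0 < state_enum G u i then service_rate G i else 0) * f (down G u i))) UNIV"
    by (intro has_sum_add has_sum_finite_sum has_sum_if_eq finite)
  then show ?thesis
    by (rule has_sum_cong[THEN iffD1, rotated])
      (auto simp: transition_rate_eq distrib_right sum_distrib_right intro!:
        arg_cong2[where f = "(+)"] sum.cong)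
qed

lemma transition_row_sum: "((\<lambda>v. transition_rate G \<eta> u v) has_sum exit_rate G \<eta> u) UNIV"
  using transition_row[of \<eta> u "\<lambda>_. 1"] by (simp add: exit_rate_def)

lemma transition_column:
  "((\<lambda>u. h u * transition_rate G \<eta> u v) has_sum
     (\<Sum>i\<in>UNIV. if 0 < state_enum G v i
        then h (down G v i) * arrival_rate G \<eta> (down G v i) i else 0) +
     (\<Sum>i\<in>UNIV. h (up G v i) * service_rate G i)) UNIV"
proof -
  have "((\<lambda>u. (\<Sum>i\<in>UNIV. if u = down G v i then (if 0 < state_enum G v i
        then h (down G v i) * arrival_rate G \<eta> (down G v i) i else 0) else 0) +
     (\<Sum>i\<in>UNIV. if u = up G v i then h (up G v i) * service_rate G i else 0)) has_sum
     (\<Sum>i\<in>UNIV. if 0 < state_enum G v i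
        then h (down G v i) * arrival_rate G \<eta> (down G v i) i else 0) +
     (\<Sum>i\<in>UNIV. h (up G v i) * service_rate G i)) UNIV"
    by (intro has_sum_add has_sum_finite_sum has_sum_if_eq finite)
  then show ?thesis
    by (rule has_sum_cong[THEN iffD1, rotated])
      (auto simp: transition_rate_eq' distrib_left sum_distrib_left intro!:
        arg_cong2[where f = "(+)"] sum.cong)
qed

lemma stationary_iff:
  "stationary (transition_rate G \<eta>) p \<longleftrightarrow>
     (\<forall>v. ((\<lambda>u. pmf p u * transition_rate G \<eta> u v) has_sum pmf p v * exit_rate G \<eta> v) UNIV)"
  unfolding stationary_def using infsumI[OF transition_row_sum] by simp

lemma arrival_rate_nonneg: "0 \<le> arrival_rate G \<eta> u i"
  unfolding arrival_rate_def
  by (intro add_nonneg_nonneg sum_nonneg mult_nonneg_nonneg)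
    (auto simp: primary_rate_nonneg overlap_rate_nonneg)

lemma arrival_rate_le: "arrival_rate G \<eta> u i \<le> primary_rate G i + sum (overlap_rate G) (hyperedges G)"
  unfolding arrival_rate_def
  by (intro add_left_mono sum_mono mult_left_le_one_le) (auto simp: overlap_rate_nonneg pmf_le_1)

lemma transition_rate_nonneg: "0 \<le> transition_rate G \<eta> u v"
  unfolding transition_rate_eq
  by (intro add_nonneg_nonneg sum_nonneg)
    (auto simp: arrival_rate_nonneg service_rate_pos less_imp_le)

lemma exit_rate_le:
  "exit_rate G \<eta> u \<le> (\<Sum>i\<in>UNIV. primary_rate G i + sum (overlap_rate G) (hyperedges G)) +
     sum (service_rate G) UNIV"
  unfolding exit_rate_def
  by (intro add_mono sum_mono arrival_rate_le) (simp add: service_rate_pos less_imp_le)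

lemma exit_rate_nonneg: "0 \<le> exit_rate G \<eta> u"
  using transition_row_sum transition_rate_nonneg has_sum_nonneg by blast

text \<open>Departures alone empty the system under any policy, since service rates are positive:
  induction on the total number of calls. The empty state plays the role of \<open>z\<close> in
  \<open>stationary_unique\<close>.\<close>

lemma reach_empty_state:
  "(u, inv (state_enum G) (\<lambda>_. 0)) \<in> {(u, v). 0 < transition_rate G \<eta> u v}\<^sup>*"
proof (induction "\<Sum>i\<in>UNIV. state_enum G u i" arbitrary: u rule: less_induct)
  case less
  show ?case
  proof (cases "\<forall>i. state_enum G u i = 0")
    case True
    then have "state_enum G u = (\<lambda>_. 0)" by auto
    then show ?thesis by (metis inv_state_enum rtrancl.rtrancl_refl)
  next
    case False
    then obtain i where i: "0 < state_enum G u i" by auto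
    have "(\<Sum>j\<in>UNIV. state_enum G (down G u i) j) < (\<Sum>j\<in>UNIV. state_enum G u j)"
      by (rule sum_strict_mono_ex1) (use i in auto)
    note less[OF this]
    moreover have "0 < transition_rate G \<eta> u (down G u i)"
    proof -
      have "0 < (\<Sum>j\<in>UNIV. if down G u i = down G u j
          then (if 0 < state_enum G u j then service_rate G j else 0) else 0)"
        by (rule sum_pos2[of _ i]) (use i service_rate_pos in \<open>auto simp: less_imp_le\<close>)
      moreover have "0 \<le> (\<Sum>j\<in>UNIV. if down G u i = up G u j then arrival_rate G \<eta> u j else 0)"
        by (intro sum_nonneg) (simp add: arrival_rate_nonneg)
      ultimately show ?thesis unfolding transition_rate_eq by linarith
    qed
    ultimately show ?thesis by (meson CollectI case_prodI converse_rtrancl_into_rtrancl)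
  qed
qed

text \<open>Uniqueness justifies the definite description in \<open>stationary_dist\<close>: any
  stationary law that can be exhibited is the one meant.\<close>

lemma stationary_distI:
  assumes "stationary (transition_rate G \<eta>) p"
  shows "stationary_dist G \<eta> = p"
  unfolding stationary_dist_def
proof (rule the_equality)
  show "p' = p" if "stationary (transition_rate G \<eta>) p'" for p'
    by (rule stationary_unique[OF transition_rate_nonneg transition_row_sum exit_rate_le
          reach_empty_state that assms])
qed (rule assms)

text \<open>
  Stationarity applied to the test functions \<open>min n\<^sub>i K\<close>, followed by \<open>K \<longrightarrow> \<infinity>\<close>: the number of calls
  at a server is not assumed to be integrable.
\<close>

lemma stationary_rate_balance:
  assumes p: "stationary (transition_rate G \<eta>) p"
  shows "measure_pmf.expectation p (\<lambda>u. arrival_rate G \<eta> u i) =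
    service_rate G i * measure_pmf.prob p {u. 0 < state_enum G u i}"
proof -
  define M where "M = primary_rate G i + sum (overlap_rate G) (hyperedges G) + service_rate G i"
  \<comment> \<open>\<open>d K\<close> is the drift of \<open>min n K\<close> for the queue length
    \<open>n\<close> at server \<open>i\<close>: an arrival raises it only if \<open>n < K\<close>,
    a departure lowers it only if \<open>0 < n\<close> and \<open>n \<le> K\<close>. Its limit for
    large \<open>K\<close> is \<open>l\<close>.\<close>
  define d where "d K u = (if state_enum G u i < K then arrival_rate G \<eta> u i else 0) -
    (if 0 < state_enum G u i \<and> state_enum G u i \<le> K then service_rate G i else 0)" for K u
  define l where "l u = arrival_rate G \<eta> u i -
    (if 0 < state_enum G u i then service_rate G i else 0)" for u
  have d_le: "\<bar>d K u\<bar> \<le> M" for K u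
    using arrival_rate_nonneg[of \<eta> u i] arrival_rate_le[of \<eta> u i] service_rate_pos[of i]
    by (auto simp: d_def M_def)
  have "measure_pmf.expectation p (d K) = 0" for K
  proof -
    define f where "f u = real (min (state_enum G u i) K)" for u
    let ?C = "(\<Sum>i\<in>UNIV. primary_rate G i + sum (overlap_rate G) (hyperedges G)) +
      sum (service_rate G) UNIV"
    define g where "g u = (\<Sum>j\<in>UNIV. arrival_rate G \<eta> u j * f (up G u j)) +
      (\<Sum>j\<in>UNIV. (if 0 < state_enum G u j then service_rate G j else 0) * f (down G u j))" for u
    have f_le: "\<bar>f u\<bar> \<le> real K" for u by (simp add: f_def)
    have up: "f (up G u j) = f u + (if j = i \<and> state_enum G u i < K then 1 else 0)" for u j
      by (auto simp: f_def)
    have down: "f (down G u j) =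
        f u - (if j = i \<and> 0 < state_enum G u i \<and> state_enum G u i \<le> K then 1 else 0)" for u j
      by (auto simp: f_def min_def of_nat_diff)
    \<comment> \<open>\<open>g\<close> is the off-diagonal part of the generator applied to
      \<open>f\<close>; subtracting the diagonal part \<open>exit_rate G \<eta> u * f u\<close>
      leaves the drift.\<close>
    have "g u = exit_rate G \<eta> u * f u + d K u" for u
    proof -
      have "(\<Sum>j\<in>UNIV. arrival_rate G \<eta> u j * f (up G u j)) =
          (\<Sum>j\<in>UNIV. arrival_rate G \<eta> u j * f u +
            (if j = i then (if state_enum G u i < K then arrival_rate G \<eta> u i else 0) else 0))"
        by (intro sum.cong refl) (simp add: up distrib_left)
      moreover have "(\<Sum>j\<in>UNIV. (if 0 < state_enum G u j then service_rate G j else 0) *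
            f (down G u j)) =
          (\<Sum>j\<in>UNIV. (if 0 < state_enum G u j then service_rate G j else 0) * f u -
            (if j = i then (if 0 < state_enum G u i \<and> state_enum G u i \<le> K
              then service_rate G i else 0) else 0))"
        by (intro sum.cong refl) (simp add: down right_diff_distrib)
      ultimately show ?thesis 
        by (simp add: g_def exit_rate_def d_def distrib_right sum.distrib sum_subtractf
            sum_distrib_right)
    qed
    note g = this
    have b: "\<bar>exit_rate G \<eta> u * f u\<bar> \<le> ?C * real K" for u
      unfolding abs_mult
      by (rule mult_mono) (use exit_rate_nonneg[of \<eta> u] exit_rate_le[of \<eta> u] f_le[of u] in auto)
    have "((\<lambda>u. pmf p u * g u) has_sum
        measure_pmf.expectation p (\<lambda>u. exit_rate G \<eta> u * f u)) UNIV"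
    proof (rule has_sum_rates_swap[OF transition_rate_nonneg transition_row_sum exit_rate_le _ f_le])
      show "(\<lambda>u. \<bar>pmf p u\<bar>) summable_on UNIV" using has_sum_pmf by (auto simp: summable_on_def)
      show "((\<lambda>v. transition_rate G \<eta> u v * f v) has_sum g u) UNIV" for u
        unfolding g_def by (rule transition_row)
      show "((\<lambda>u. pmf p u * transition_rate G \<eta> u v) has_sum pmf p v * exit_rate G \<eta> v) UNIV" for v
        using p by (simp add: stationary_iff)
      show "((\<lambda>v. pmf p v * exit_rate G \<eta> v * f v) has_sum
          measure_pmf.expectation p (\<lambda>u. exit_rate G \<eta> u * f u)) UNIV"
        using has_sum_pmf_expectation[OF b] by (simp add: mult.assoc)
    qed
    from has_sum_minus[OF this has_sum_pmf_expectation[where f = "\<lambda>u. exit_rate G \<eta> u * f u", OF b, of p]]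
    have "((\<lambda>u. pmf p u * d K u) has_sum 0) UNIV" by (simp add: g distrib_left)
    with has_sum_pmf_expectation[where f = "d K", OF d_le] show ?thesis
      using has_sum_unique by blast
  qed
  \<comment> \<open>At each state both cut-offs become inactive once \<open>K\<close> exceeds the
    queue length, and the constant \<open>M\<close> dominates all the drifts.\<close>
  moreover have "(\<lambda>K. measure_pmf.expectation p (d K)) \<longlonglongrightarrow> measure_pmf.expectation p l"
  proof (rule integral_dominated_convergence[where w = "\<lambda>_. M"])
    have "\<forall>\<^sub>F K in sequentially. d K u = l u" for u
      using eventually_gt_at_top[of "state_enum G u i"] by eventually_elim (simp add: d_def l_def)
    then show "AE u in measure_pmf p. (\<lambda>K. d K u) \<longlonglongrightarrow> l u"
      by (simp add: tendsto_eventually)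
  qed (use d_le in auto)
  ultimately have "measure_pmf.expectation p l = 0"
    by (simp add: LIMSEQ_const_iff)
  moreover have "measure_pmf.expectation p l =
      measure_pmf.expectation p (\<lambda>u. arrival_rate G \<eta> u i) -
      measure_pmf.expectation p (\<lambda>u. service_rate G i * indicator {u. 0 < state_enum G u i} u)"
  proof -
    have "l = (\<lambda>u. arrival_rate G \<eta> u i - service_rate G i * indicator {u. 0 < state_enum G u i} u)"
      by (auto simp: l_def fun_eq_iff)
    moreover have "integrable p (\<lambda>u. arrival_rate G \<eta> u i)"
      by (rule measure_pmf.integrable_const_bound
          [where B = "primary_rate G i + sum (overlap_rate G) (hyperedges G)"])
        (simp_all add: arrival_rate_nonneg arrival_rate_le)
    moreover have "integrable p (\<lambda>u. service_rate G i * indicator {u. 0 < state_enum G u i} u)"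
      by (rule measure_pmf.integrable_const_bound[where B = "service_rate G i"])
        (use service_rate_pos[of i] in \<open>auto simp: indicator_def\<close>)
    ultimately show ?thesis by (simp only: Bochner_Integration.integral_diff)
  qed
  ultimately show ?thesis by simp
qed

end

section \<open>Policies and flows\<close>

lemma measure_geometric_pmf_pos:
  assumes "0 < p" "p \<le> 1"
  shows "measure_pmf.prob (geometric_pmf p) {n. 0 < n} = 1 - p"
proof -
  have "{n. 0 < n} = UNIV - {0 :: nat}" by auto
  then show ?thesis
    using measure_pmf.prob_compl[of "{0}" "geometric_pmf p"] assms by (simp add: measure_pmf_single)
qed

context
  fixes G :: "'i::finite dispatch_system"
  assumes valid: "valid_system G"
begin

text \<open>State-independent arrivals decouple the servers into independent M/M/1 queues, whose
  equilibrium is geometric with ratio \<open>a i / service_rate G i\<close>. The parameter of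
  \<open>geometric_pmf\<close> is the success probability, hence the complement.\<close>

lemma product_geometric_stationary:
  assumes arr: "\<And>u i. arrival_rate G \<eta> u i = a i" and lt: "\<And>i. a i < service_rate G i"
  defines "p \<equiv> map_pmf (inv (state_enum G))
    (Pi_pmf UNIV 0 (\<lambda>i. geometric_pmf (1 - a i / service_rate G i)))"
  shows "stationary (transition_rate G \<eta>) p"
    and "measure_pmf.prob p {u. 0 < state_enum G u i} = a i / service_rate G i"
proof -
  define r where "r i = a i / service_rate G i" for i
  have a0: "0 \<le> a i" for i using arrival_rate_nonneg[OF valid] arr by metis
  have \<mu>: "0 < service_rate G i" for i by (rule service_rate_pos[OF valid])
  have r0: "0 \<le> r i" for i unfolding r_def by (rule divide_nonneg_pos[OF a0 \<mu>])
  have r1: "r i < 1" for i using \<mu> lt by (simp add: r_def)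
  have geo: "pmf (geometric_pmf (1 - r i)) n = r i ^ n * (1 - r i)" for i n
    using pmf_geometric[of "1 - r i"] r0[of i] r1[of i] by simp
  have "inj (inv (state_enum G))" by (rule injI) (metis state_enum_inv[OF valid])
  then have pmf_p: "pmf p u = (\<Prod>i\<in>UNIV. r i ^ state_enum G u i * (1 - r i))" for u
    using pmf_map_inj'[of "inv (state_enum G)" _ "state_enum G u"]
    by (simp add: p_def inv_state_enum[OF valid] pmf_Pi geo flip: r_def)
  have up: "pmf p (up G u i) = r i * pmf p u" for u i
  proof -
    have "pmf p (up G u i) =
        (\<Prod>j\<in>UNIV. (if j = i then r i else 1) * (r j ^ state_enum G u j * (1 - r j)))"
      unfolding pmf_p by (intro prod.cong refl) (simp add: state_enum_up[OF valid])
    then show ?thesis by (simp add: prod.distrib pmf_p)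
  qed
  \<comment> \<open>Detailed balance between a state and its upper neighbour; \<open>down_a\<close>
    is the same identity seen from the upper state.\<close>
  have up_a: "pmf p (up G u i) * service_rate G i = pmf p u * a i" for u i
    using \<mu>[of i] by (simp add: up r_def)
  have down_a: "pmf p (down G u i) * a i = pmf p u * service_rate G i"
    if "0 < state_enum G u i" for u i
    using up_a[of "down G u i" i] eq_up_iff[OF valid, of u "down G u i" i] that by simp
  \<comment> \<open>Detailed balance matches terms: inflow by arrivals equals outflow by departures,
    and inflow by departures equals outflow by arrivals.\<close>
  have "((\<lambda>u. pmf p u * transition_rate G \<eta> u v) has_sum pmf p v * exit_rate G \<eta> v) UNIV" for v
  proof -
    have "(\<Sum>i\<in>UNIV. if 0 < state_enum G v i
        then pmf p (down G v i) * arrival_rate G \<eta> (down G v i) i else 0) +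
        (\<Sum>i\<in>UNIV. pmf p (up G v i) * service_rate G i) = pmf p v * exit_rate G \<eta> v"
      by (simp add: exit_rate_def arr up_a down_a distrib_left sum_distrib_left add.commute
          if_distrib[of "(*) _"] cong: if_cong)
    then show ?thesis using transition_column[OF valid, of "pmf p" \<eta> v] by simp
  qed
  then show "stationary (transition_rate G \<eta>) p" by (simp add: stationary_iff[OF valid])
  have "map_pmf (\<lambda>u. state_enum G u i) p = geometric_pmf (1 - r i)"
    by (simp add: p_def map_pmf_comp state_enum_inv[OF valid] Pi_pmf_component r_def)
  then have "measure_pmf.prob p {u. 0 < state_enum G u i} =
      measure_pmf.prob (geometric_pmf (1 - r i)) {n. 0 < n}"
    using measure_map_pmf[of "\<lambda>u. state_enum G u i" p "{n. 0 < n}"] by (simp add: vimage_def)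
  then show "measure_pmf.prob p {u. 0 < state_enum G u i} = a i / service_rate G i"
    using r0[of i] r1[of i] by (simp add: measure_geometric_pmf_pos flip: r_def)
qed

section \<open>Correspondence between flows and dispatch policies\<close>

lemma flow_le_overlap_rate:
  assumes "x \<in> flows G" "e \<in> hyperedges G" "i \<in> e"
  shows "0 \<le> x e i" "x e i \<le> overlap_rate G e"
proof -
  have *: "\<And>i. i \<in> e \<Longrightarrow> 0 \<le> x e i" "(\<Sum>i\<in>e. x e i) = overlap_rate G e"
    using assms by (auto simp: flows_def)
  show "0 \<le> x e i" using * assms by blast
  show "x e i \<le> overlap_rate G e" using member_le_sum[of i e "x e"] * assms by simp
qed

lemma pmf_eq_0_of_markov_policy:
  "markov_policy G \<eta> \<Longrightarrow> e \<in> hyperedges G \<Longrightarrow> i \<notin> e \<Longrightarrow> pmf (\<eta> e u) i = 0"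
  by (auto simp: markov_policy_def pmf_eq_0_set_pmf)

text \<open>For a region of rate 0 the arbitrary distribution contributes nothing, in agreement with
  the flow constraints, which force \<open>x e i = 0\<close> there.\<close>

lemma arrival_rate_induced_policy:
  assumes x: "x \<in> flows G" and \<eta>: "induced_policy G x \<eta>"
  shows "arrival_rate G \<eta> u i = inflow G x i"
proof -
  have "pmf (\<eta> e u) i * overlap_rate G e = (if i \<in> e then x e i else 0)"
    if e: "e \<in> hyperedges G" for e
  proof (cases "i \<in> e")
    case True
    then show ?thesis
      using \<eta> e flow_le_overlap_rate[OF x e, of i]
      by (cases "overlap_rate G e = 0") (auto simp: induced_policy_def)
  next
    case False
    then show ?thesis using \<eta> e pmf_eq_0_of_markov_policy by (simp add: induced_policy_def)
  qed
  then show ?thesis by (simp add: arrival_rate_def inflow_def sum.inter_filter)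
qed

lemma induced_policy_stable:
  assumes x: "x \<in> flows G" and \<eta>: "induced_policy G x \<eta>" and lt: "\<And>i. flow_workload G x i < 1"
  shows "\<eta> \<in> stable_policies G" and "workload G \<eta> = flow_workload G x"
proof -
  have "inflow G x i < service_rate G i" for i
    using lt[of i] service_rate_pos[OF valid, of i] by (simp add: flow_workload_def)
  note p = product_geometric_stationary[OF arrival_rate_induced_policy[OF x \<eta>] this]
  show "\<eta> \<in> stable_policies G"
    using p(1) \<eta> by (auto simp: stable_policies_def induced_policy_def)
  show "workload G \<eta> = flow_workload G x"
    using p(2) by (auto simp: workload_def flow_workload_def stationary_distI[OF valid p(1)])
qed

text \<open>Normalizing the flow gives the distribution for a region of positive rate; for rate 0 a
  point mass at some server of the nonempty region serves.\<close>

lemma ex_induced_policy: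
  assumes x: "x \<in> flows G"
  shows "\<exists>\<eta>. induced_policy G x \<eta>"
proof -
  have "\<exists>d. set_pmf d \<subseteq> e \<and>
      (overlap_rate G e \<noteq> 0 \<longrightarrow> (\<forall>i\<in>e. pmf d i = x e i / overlap_rate G e))"
    if e: "e \<in> hyperedges G" for e
  proof (cases "overlap_rate G e = 0")
    case True
    obtain i where "i \<in> e" using hyperedge_nonempty[OF valid e] by blast
    then show ?thesis using True by (intro exI[of _ "return_pmf i"]) simp
  next
    case False
    then have pos: "0 < overlap_rate G e" using overlap_rate_nonneg[OF valid e] by simp
    define f where "f i = (if i \<in> e then x e i / overlap_rate G e else 0)" for i
    have f0: "0 \<le> f i" for i
      using flow_le_overlap_rate(1)[OF x e] pos by (simp add: f_def)
    have "(\<Sum>i\<in>UNIV. f i) = (\<Sum>i\<in>e. x e i) / overlap_rate G e"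
      by (simp add: f_def sum.If_cases sum_divide_distrib)
    also have "\<dots> = 1" using x e pos by (simp add: flows_def)
    finally have "(\<integral>\<^sup>+ i. ennreal (f i) \<partial>count_space UNIV) = 1"
      by (simp add: nn_integral_count_space_finite sum_ennreal f0)
    then have pmf: "pmf (embed_pmf f) i = f i" for i using f0 by (simp add: pmf_embed_pmf)
    then show ?thesis by (intro exI[of _ "embed_pmf f"]) (auto simp: set_pmf_iff f_def split: if_splits)
  qed
  then have "\<forall>e\<in>hyperedges G. \<exists>d. set_pmf d \<subseteq> e \<and>
      (overlap_rate G e \<noteq> 0 \<longrightarrow> (\<forall>i\<in>e. pmf d i = x e i / overlap_rate G e))" by blast
  then obtain d where "\<forall>e\<in>hyperedges G. set_pmf (d e) \<subseteq> e \<and>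
      (overlap_rate G e \<noteq> 0 \<longrightarrow> (\<forall>i\<in>e. pmf (d e) i = x e i / overlap_rate G e))"
    by (auto dest!: bchoice)
  then show ?thesis
    by (intro exI[of _ "\<lambda>e u. d e"])
      (simp add: induced_policy_def markov_policy_def state_independent_def)
qed

text \<open>The flow is the long-run one: dispatch probabilities averaged over the stationary law,
  times the rate of the region. Its inflow is the mean arrival rate, which rate balance equates with
  service rate times workload.\<close>

lemma stable_workload_eq_flow_workload:
  assumes "\<eta> \<in> stable_policies G"
  obtains x where "x \<in> flows G" "workload G \<eta> = flow_workload G x"
proof -
  obtain p where p: "stationary (transition_rate G \<eta>) p" and \<eta>: "markov_policy G \<eta>"
    using assms by (auto simp: stable_policies_def)
  have int: "integrable (measure_pmf p) (\<lambda>u. pmf (\<eta> e u) i)" for e i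
    by (rule measure_pmf.integrable_const_bound[where B = 1]) (simp_all add: pmf_le_1)
  define x where "x e i = measure_pmf.expectation p (\<lambda>u. pmf (\<eta> e u) i) * overlap_rate G e" for e i
  have "x \<in> flows G"
    unfolding flows_def
  proof (intro CollectI ballI conjI)
    fix e assume e: "e \<in> hyperedges G"
    show "0 \<le> x e i" for i
      using overlap_rate_nonneg[OF valid e] by (simp add: x_def)
    have "(\<Sum>i\<in>e. pmf (\<eta> e u) i) = 1" for u
      using \<eta> e by (intro sum_pmf_eq_1) (auto simp: markov_policy_def)
    then have "measure_pmf.expectation p (\<lambda>u. \<Sum>i\<in>e. pmf (\<eta> e u) i) = 1" by simp
    then have "(\<Sum>i\<in>e. measure_pmf.expectation p (\<lambda>u. pmf (\<eta> e u) i)) = 1"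
      by (simp add: Bochner_Integration.integral_sum int)
    then show "(\<Sum>i\<in>e. x e i) = overlap_rate G e" by (simp add: x_def flip: sum_distrib_right)
  qed
  moreover have "workload G \<eta> i = flow_workload G x i" for i
  proof -
    have "x e i = 0" if "e \<in> hyperedges G" "i \<notin> e" for e
      using that pmf_eq_0_of_markov_policy[OF \<eta>] by (simp add: x_def)
    then have "inflow G x i = primary_rate G i + (\<Sum>e\<in>hyperedges G. x e i)"
      unfolding inflow_def by (intro arg_cong2[where f = "(+)"] sum.mono_neutral_left) auto
    also have "\<dots> = measure_pmf.expectation p (\<lambda>u. arrival_rate G \<eta> u i)"
      by (simp add: arrival_rate_def x_def int Bochner_Integration.integral_sum)
    finally show ?thesis
      using service_rate_pos[OF valid, of i]
      by (simp add: stationary_rate_balance[OF valid p] workload_def stationary_distI[OF valid p]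
          flow_workload_def)
  qed
  ultimately show ?thesis using that by blast
qed

end

section \<open>Balanced flows\<close>

text \<open>First-order optimality condition for \<open>flow_energy\<close>, written as pairwise
  comparisons; \<open>balanced_flow_iff_Min\<close> gives the form with the minimum.\<close>

definition balanced_flow :: "'i::finite dispatch_system \<Rightarrow> ('i set \<Rightarrow> 'i \<Rightarrow> real) \<Rightarrow> bool" where
  "balanced_flow G x \<longleftrightarrow> (\<forall>e\<in>hyperedges G. \<forall>i\<in>e. \<forall>j\<in>e.
     0 < x e i \<longrightarrow> flow_workload G x i \<le> flow_workload G x j)"

text \<open>Dividing by the service rate makes the derivative in a coordinate \<open>x e i\<close>
  equal to twice the workload of \<open>i\<close>, so that optimality compares workloads even for
  unequal service rates.\<close>

definition flow_energy :: "'i::finite dispatch_system \<Rightarrow> ('i set \<Rightarrow> 'i \<Rightarrow> real) \<Rightarrow> real" where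
  "flow_energy G x = (\<Sum>i\<in>UNIV. (inflow G x i)\<^sup>2 / service_rate G i)"

text \<open>Summation by server exchanged for summation by region. The weights \<open>w\<close> are
  later the workloads of a fixed flow or constantly 1.\<close>

lemma sum_inflow:
  "(\<Sum>i\<in>S. w i * inflow G x i) =
     (\<Sum>i\<in>S. w i * primary_rate G i) + (\<Sum>e\<in>hyperedges G. \<Sum>i\<in>e \<inter> S. w i * x e i)"
proof -
  have "(\<Sum>i\<in>S. w i * (\<Sum>e\<in>{e \<in> hyperedges G. i \<in> e}. x e i)) =
      (\<Sum>i\<in>S. \<Sum>e\<in>hyperedges G. if i \<in> e then w i * x e i else 0)"
    by (simp add: sum_distrib_left sum.inter_filter if_distrib[of "(*) _"] cong: if_cong)
  also have "\<dots> = (\<Sum>e\<in>hyperedges G. \<Sum>i\<in>S. if i \<in> e then w i * x e i else 0)"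
    by (rule sum.swap)
  also have "\<dots> = (\<Sum>e\<in>hyperedges G. \<Sum>i\<in>e \<inter> S. w i * x e i)"
    by (simp add: sum.If_cases Int_commute)
  finally show ?thesis by (simp add: inflow_def distrib_left sum.distrib)
qed

context
  fixes G :: "'i::finite dispatch_system"
  assumes valid: "valid_system G"
begin

lemma inflow_eq: "inflow G x i = service_rate G i * flow_workload G x i"
  using service_rate_pos[OF valid, of i] by (simp add: flow_workload_def)

lemma capacity_pos: "S \<noteq> {} \<Longrightarrow> 0 < capacity G S"
  unfolding capacity_def by (intro sum_pos) (auto simp: service_rate_pos[OF valid])

text \<open>Regard the workloads of \<open>x\<close> as fixed prices. In each region
  \<open>x\<close> uses only the cheapest servers, while \<open>y\<close> carries the same total at
  a price no lower.\<close>

lemma balanced_flow_variational: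
  assumes x: "x \<in> flows G" and bal: "balanced_flow G x" and y: "y \<in> flows G"
  shows "(\<Sum>i\<in>UNIV. flow_workload G x i * inflow G x i) \<le>
    (\<Sum>i\<in>UNIV. flow_workload G x i * inflow G y i)"
proof -
  let ?\<rho> = "flow_workload G x"
  have "(\<Sum>i\<in>e. ?\<rho> i * x e i) \<le> (\<Sum>i\<in>e. ?\<rho> i * y e i)" if e: "e \<in> hyperedges G" for e
  proof -
    let ?m = "Min (?\<rho> ` e)"
    have ne: "e \<noteq> {}" using hyperedge_nonempty[OF valid e] .
    have "?\<rho> i * x e i = ?m * x e i" if "i \<in> e" for i
    proof (cases "x e i = 0")
      case False
      then have "0 < x e i" using flow_le_overlap_rate[OF valid x e that] by simp
      then have "?m = ?\<rho> i" using bal e that by (intro Min_eqI) (auto simp: balanced_flow_def)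
      then show ?thesis by simp
    qed simp
    then have "(\<Sum>i\<in>e. ?\<rho> i * x e i) = (\<Sum>i\<in>e. ?m * x e i)" by (rule sum.cong[OF refl])
    also have "\<dots> = ?m * overlap_rate G e"
      using x e by (simp add: flows_def flip: sum_distrib_left)
    also have "\<dots> = (\<Sum>i\<in>e. ?m * y e i)"
      using y e by (simp add: flows_def flip: sum_distrib_left)
    also have "\<dots> \<le> (\<Sum>i\<in>e. ?\<rho> i * y e i)"
      using flow_le_overlap_rate[OF valid y e] by (intro sum_mono mult_right_mono) auto
    finally show ?thesis .
  qed
  then show ?thesis by (simp add: sum_inflow sum_mono)
qed

lemma flow_energy_eq: "flow_energy G x = (\<Sum>i\<in>UNIV. flow_workload G x i * inflow G x i)"
  by (simp add: flow_energy_def flow_workload_def power2_eq_square)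

text \<open>Expand the energy of \<open>y\<close> around \<open>x\<close>: the linear term is
  nonnegative by the variational inequality, and the quadratic remainder is kept because it yields
  uniqueness.\<close>

lemma balanced_flow_energy_le:
  assumes x: "x \<in> flows G" and bal: "balanced_flow G x" and y: "y \<in> flows G"
  shows "flow_energy G x +
    (\<Sum>i\<in>UNIV. service_rate G i * (flow_workload G y i - flow_workload G x i)\<^sup>2) \<le> flow_energy G y"
proof -
  have "flow_energy G y = flow_energy G x +
      (\<Sum>i\<in>UNIV. service_rate G i * (flow_workload G y i - flow_workload G x i)\<^sup>2) +
      2 * ((\<Sum>i\<in>UNIV. flow_workload G x i * inflow G y i) -
        (\<Sum>i\<in>UNIV. flow_workload G x i * inflow G x i))"
    unfolding flow_energy_eq sum_subtractf[symmetric] sum_distrib_left sum.distrib[symmetric]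
    by (intro sum.cong refl) (simp add: inflow_eq power2_eq_square algebra_simps)
  then show ?thesis using balanced_flow_variational[OF assms] by simp
qed

text \<open>Shifting a little flow of \<open>e\<close> from \<open>i\<close> to a less loaded \<open>j \<in> e\<close> lowers the energy to first order.\<close>

lemma minimal_energy_imp_balanced_flow:
  assumes x: "x \<in> flows G" and min: "\<And>y. y \<in> flows G \<Longrightarrow> flow_energy G x \<le> flow_energy G y"
  shows "balanced_flow G x"
  unfolding balanced_flow_def
proof (intro ballI impI, rule ccontr)
  fix e i j assume e: "e \<in> hyperedges G" and i: "i \<in> e" and j: "j \<in> e" and pos: "0 < x e i"
    and "\<not> flow_workload G x i \<le> flow_workload G x j"
  then have gt: "flow_workload G x j < flow_workload G x i" by simp
  then have ij: "i \<noteq> j" by auto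
  define gap where "gap = flow_workload G x i - flow_workload G x j"
  define c where "c = 1 / service_rate G i + 1 / service_rate G j"
  \<comment> \<open>The first bound keeps the shifted flow nonnegative; the second makes the energy
    change \<open>\<epsilon> * (\<epsilon> * c - 2 * gap)\<close> negative.\<close>
  define \<epsilon> where "\<epsilon> = min (x e i) (gap / c)"
  have \<mu>: "0 < service_rate G k" for k by (rule service_rate_pos[OF valid])
  have c: "0 < c" using \<mu>[of i] \<mu>[of j] by (simp add: c_def add_pos_pos)
  have gap: "0 < gap" using gt by (simp add: gap_def)
  have \<epsilon>: "0 < \<epsilon>" "\<epsilon> \<le> x e i" "\<epsilon> * c \<le> gap"
    using c gap pos by (simp_all add: \<epsilon>_def flip: pos_le_divide_eq)
  define d where "d k = (if k = j then \<epsilon> else 0) - (if k = i then \<epsilon> else 0)" for k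
  define y where "y e' k = x e' k + (if e' = e then d k else 0)" for e' k
  have "(\<Sum>k\<in>e. d k) = 0" using i j by (simp add: d_def sum_subtractf)
  then have "(\<Sum>k\<in>e'. if e' = e then d k else 0) = 0" for e' by (cases "e' = e") simp_all
  moreover have "0 \<le> y e' k" if "e' \<in> hyperedges G" "k \<in> e'" for e' k
    using flow_le_overlap_rate(1)[OF valid x that] \<epsilon> ij by (auto simp: y_def d_def)
  ultimately have "y \<in> flows G"
    using x by (auto simp: flows_def y_def sum.distrib)
  have d0: "k \<notin> e \<Longrightarrow> d k = 0" for k using i j by (auto simp: d_def)
  have inflow_y: "inflow G y k = inflow G x k + d k" for k
  proof -
    have "(\<Sum>e'\<in>{e' \<in> hyperedges G. k \<in> e'}. if e' = e then d k else 0) = d k"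
      using e d0[of k] by (cases "k \<in> e") auto
    then show ?thesis by (simp add: inflow_def y_def sum.distrib)
  qed
  have "flow_energy G y - flow_energy G x =
      (\<Sum>k\<in>UNIV. 2 * flow_workload G x k * d k + (d k)\<^sup>2 / service_rate G k)"
    unfolding flow_energy_def sum_subtractf[symmetric]
  proof (intro sum.cong refl)
    fix k
    show "(inflow G y k)\<^sup>2 / service_rate G k - (inflow G x k)\<^sup>2 / service_rate G k =
        2 * flow_workload G x k * d k + (d k)\<^sup>2 / service_rate G k"
      using \<mu>[of k] by (simp add: inflow_y flow_workload_def power2_eq_square field_simps)
  qed
  also have "\<dots> = (\<Sum>k\<in>{i, j}. 2 * flow_workload G x k * d k + (d k)\<^sup>2 / service_rate G k)"
    by (intro sum.mono_neutral_right) (auto simp: d_def)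
  also have "\<dots> = \<epsilon> * (\<epsilon> * c - 2 * gap)"
    using ij by (simp add: d_def gap_def c_def power2_eq_square algebra_simps)
  also have "\<dots> < 0" using \<epsilon> gap by (intro mult_pos_neg) auto
  finally show False using min[OF \<open>y \<in> flows G\<close>] by simp
qed

text \<open>\<open>flows G\<close> leaves the coordinates outside the hyperedges free and so is
  unbounded. Setting them to 0 keeps the energy and leaves a compact polytope, on which the
  continuous energy attains its minimum.\<close>

lemma ex_minimal_energy_flow:
  obtains x where "x \<in> flows G" "\<And>y. y \<in> flows G \<Longrightarrow> flow_energy G x \<le> flow_energy G y"
proof -
  define P :: "'i set \<times> 'i \<Rightarrow> bool" where "P p \<longleftrightarrow> fst p \<in> hyperedges G \<and> snd p \<in> fst p" for p
  define X :: "real ^ ('i set \<times> 'i) \<Rightarrow> 'i set \<Rightarrow> 'i \<Rightarrow> real" where "X z e i = z $ (e, i)" for z e i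
  define b :: "real ^ ('i set \<times> 'i)" where
    "b = (\<chi> p. if P p then overlap_rate G (fst p) else 0)"
  \<comment> \<open>The box has width 0 in the meaningless coordinates, since \<open>b\<close>
    vanishes there; in the others its bound is implied by the flow constraints.\<close>
  define K where "K = cbox 0 b \<inter>
    (\<Inter>e\<in>hyperedges G. {z. (\<Sum>i\<in>e. z $ (e, i)) = overlap_rate G e})"
  have X_flows: "X z \<in> flows G" if "z \<in> K" for z
    using that by (auto simp: K_def flows_def X_def mem_box_cart)
  have restrict: "\<exists>z\<in>K. flow_energy G (X z) = flow_energy G y" if y: "y \<in> flows G" for y
  proof -
    define z :: "real ^ ('i set \<times> 'i)" where "z = (\<chi> p. if P p then y (fst p) (snd p) else 0)"
    have "z \<in> K"
      using y flow_le_overlap_rate[OF valid y]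
      by (auto simp: K_def z_def b_def mem_box_cart P_def flows_def)
    moreover have "inflow G (X z) i = inflow G y i" for i
      unfolding inflow_def by (intro arg_cong2[where f = "(+)"] sum.cong) (auto simp: X_def z_def P_def)
    ultimately show ?thesis by (intro bexI[of _ z]) (simp_all add: flow_energy_def)
  qed
  have "compact K" unfolding K_def
    by (intro compact_Int_closed compact_cbox closed_INT ballI closed_Collect_eq continuous_intros)
  moreover have "K \<noteq> {}"
  proof -
    have "(\<lambda>e i. overlap_rate G e / real (card e)) \<in> flows G"
      using overlap_rate_nonneg[OF valid] hyperedge_nonempty[OF valid] by (auto simp: flows_def)
    then show ?thesis using restrict by blast
  qed
  moreover have "continuous_on K (\<lambda>z. flow_energy G (X z))"
    unfolding flow_energy_def inflow_def X_def
    by (intro continuous_intros) (simp add: service_rate_pos[OF valid, THEN less_imp_neq, symmetric])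
  ultimately obtain z where "z \<in> K" "\<forall>w\<in>K. flow_energy G (X z) \<le> flow_energy G (X w)"
    using continuous_attains_inf by blast
  then show ?thesis using that X_flows restrict by metis
qed

text \<open>The quadratic remainder in \<open>balanced_flow_energy_le\<close> is squeezed to 0. This
  fixes the workloads of a minimizer, although several flows may produce them.\<close>

lemma flow_workload_eq_of_energy_le:
  assumes x: "x \<in> flows G" "balanced_flow G x" and y: "y \<in> flows G"
    and le: "flow_energy G y \<le> flow_energy G x"
  shows "flow_workload G y = flow_workload G x"
proof -
  have "(\<Sum>i\<in>UNIV. service_rate G i * (flow_workload G y i - flow_workload G x i)\<^sup>2) \<le> 0"
    using balanced_flow_energy_le[OF x y] le by simp
  then have "service_rate G i * (flow_workload G y i - flow_workload G x i)\<^sup>2 = 0" for i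
    using sum_nonneg_eq_0_iff[of UNIV
        "\<lambda>i. service_rate G i * (flow_workload G y i - flow_workload G x i)\<^sup>2"]
    by (simp add: antisym sum_nonneg service_rate_pos[OF valid] less_imp_le)
  then show ?thesis
    using service_rate_pos[OF valid] by (auto simp: fun_eq_iff) (metis less_irrefl)
qed

text \<open>A region inside \<open>S\<close> has to be served within \<open>S\<close>; the other
  regions can only add to the inflow of \<open>S\<close>.\<close>

lemma demand_le_inflow:
  assumes x: "x \<in> flows G"
  shows "demand G S \<le> (\<Sum>i\<in>S. inflow G x i)"
proof -
  have "(\<Sum>e\<in>{e \<in> hyperedges G. e \<subseteq> S}. overlap_rate G e) =
      (\<Sum>e\<in>hyperedges G. if e \<subseteq> S then overlap_rate G e else 0)"
    by (simp add: sum.inter_filter)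
  also have "\<dots> \<le> (\<Sum>e\<in>hyperedges G. \<Sum>i\<in>e \<inter> S. x e i)"
  proof (rule sum_mono)
    fix e assume e: "e \<in> hyperedges G"
    show "(if e \<subseteq> S then overlap_rate G e else 0) \<le> (\<Sum>i\<in>e \<inter> S. x e i)"
      using x e flow_le_overlap_rate(1)[OF valid x e]
      by (auto simp: flows_def Int_absorb2 intro!: sum_nonneg)
  qed
  finally show ?thesis
    using sum_inflow[of "\<lambda>_. 1" G x S] by (simp add: demand_def)
qed

text \<open>
  A balanced flow gives no work to an upper level set \<open>T\<close> from a region not contained in \<open>T\<close>.
\<close>

lemma demand_upper_set:
  assumes x: "x \<in> flows G" and bal: "balanced_flow G x"
    and upper: "\<And>i j. i \<in> T \<Longrightarrow> j \<notin> T \<Longrightarrow> flow_workload G x j < flow_workload G x i"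
  shows "demand G T = (\<Sum>i\<in>T. inflow G x i)"
proof -
  have "(\<Sum>e\<in>{e \<in> hyperedges G. e \<subseteq> T}. overlap_rate G e) =
      (\<Sum>e\<in>hyperedges G. if e \<subseteq> T then overlap_rate G e else 0)"
    by (simp add: sum.inter_filter)
  also have "\<dots> = (\<Sum>e\<in>hyperedges G. \<Sum>i\<in>e \<inter> T. x e i)"
  proof (rule sum.cong[OF refl])
    fix e assume e: "e \<in> hyperedges G"
    show "(if e \<subseteq> T then overlap_rate G e else 0) = (\<Sum>i\<in>e \<inter> T. x e i)"
    proof (cases "e \<subseteq> T")
      case True
      then show ?thesis using x e by (simp add: flows_def Int_absorb2)
    next
      case False
      then obtain j where j: "j \<in> e" "j \<notin> T" by blast
      have "x e i = 0" if "i \<in> e \<inter> T" for i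
      proof (rule ccontr)
        assume "x e i \<noteq> 0"
        then have "0 < x e i" using flow_le_overlap_rate(1)[OF valid x e, of i] that by simp
        then have "flow_workload G x i \<le> flow_workload G x j"
          using bal e j that by (auto simp: balanced_flow_def)
        then show False using upper[of i j] that j by simp
      qed
      then show ?thesis using False by simp
    qed
  qed
  finally show ?thesis
    using sum_inflow[of "\<lambda>_. 1" G x T] by (simp add: demand_def)
qed

end

section \<open>Water-filling levels of a balanced flow\<close>

context
  fixes G :: "'i::finite dispatch_system"
  assumes valid: "valid_system G"
begin

lemma demand_empty: "demand G {} = 0"
proof -
  have "{e \<in> hyperedges G. e \<subseteq> {}} = {}" using hyperedge_nonempty[OF valid] by auto
  then show ?thesis by (simp only: demand_def) simp
qed

text \<open>One water-filling step. \<open>low\<close> says that \<open>U\<close> is a lower level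
  set of the workloads, and \<open>D\<close> is the residual demand after removal of its complement.
  That complement is an upper level set, so its demand cancels against its inflow, giving
  \<open>D S \<le> v * capacity G S\<close> with equality for the most loaded servers of
  \<open>U\<close>. A set containing a less loaded server is strictly below the bound.\<close>

lemma level_bottleneck:
  assumes x: "x \<in> flows G" and bal: "balanced_flow G x" and ne: "U \<noteq> {}"
    and low: "\<And>i j. i \<notin> U \<Longrightarrow> j \<in> U \<Longrightarrow> flow_workload G x j < flow_workload G x i"
    and D: "\<And>T. T \<subseteq> U \<Longrightarrow> D T = demand G (T \<union> - U) - demand G (- U)"
  defines "v \<equiv> Max (flow_workload G x ` U)"
  shows "level G U D = v"
    and "bottleneck G U D = {i \<in> U. flow_workload G x i = v}"
    and "D {i \<in> U. flow_workload G x i = v} = v * capacity G {i \<in> U. flow_workload G x i = v}"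
    and "S \<subseteq> U \<Longrightarrow> D S = v * capacity G S \<Longrightarrow> S \<subseteq> {i \<in> U. flow_workload G x i = v}"
proof -
  let ?A = "{i \<in> U. flow_workload G x i = v}"
  have \<mu>: "0 < service_rate G k" for k by (rule service_rate_pos[OF valid])
  have inflow_le: "inflow G x i \<le> v * service_rate G i" if "i \<in> U" for i
    using that \<mu>[of i] by (simp add: inflow_eq[OF valid] v_def mult.commute)
  have compl: "demand G (- U) = (\<Sum>i\<in>- U. inflow G x i)"
    by (rule demand_upper_set[OF valid x bal]) (use low in auto)
  have split: "(\<Sum>i\<in>S \<union> - U. inflow G x i) = (\<Sum>i\<in>S. inflow G x i) + (\<Sum>i\<in>- U. inflow G x i)"
    if "S \<subseteq> U" for S
    using that by (intro sum.union_disjoint) auto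
  have D_le: "D S \<le> (\<Sum>i\<in>S. inflow G x i)" if "S \<subseteq> U" for S
    using demand_le_inflow[OF valid x, of "S \<union> - U"] split[OF that] D[OF that] compl by simp
  have inflow_capacity: "(\<Sum>i\<in>S. inflow G x i) \<le> v * capacity G S" if "S \<subseteq> U" for S
    unfolding capacity_def sum_distrib_left using that by (intro sum_mono inflow_le) auto
  have v_in: "v \<in> flow_workload G x ` U" unfolding v_def using ne by (intro Max_in) auto
  have v_ge: "flow_workload G x i \<le> v" if "i \<in> U" for i using that by (simp add: v_def)
  \<comment> \<open>Adding the most loaded servers of \<open>U\<close> to the complement gives
    another upper level set, so its demand is again all of its inflow.\<close>
  have "demand G (?A \<union> - U) = (\<Sum>i\<in>?A \<union> - U. inflow G x i)"
  proof (rule demand_upper_set[OF valid x bal])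
    show "flow_workload G x j < flow_workload G x i" if "i \<in> ?A \<union> - U" "j \<notin> ?A \<union> - U" for i j
      using that low[of i j] v_ge[of j] by (auto simp: less_le)
  qed
  then have "D ?A = (\<Sum>i\<in>?A. inflow G x i)" using split[of ?A] D[of ?A] compl by simp
  also have "\<dots> = v * capacity G ?A"
    unfolding capacity_def sum_distrib_left by (intro sum.cong) (auto simp: inflow_eq[OF valid])
  finally show D_A: "D ?A = v * capacity G ?A" .
  have A_ne: "?A \<noteq> {}" using v_in by auto
  show level: "level G U D = v"
    unfolding level_def
  proof (rule Max_eqI)
    show "y \<le> v" if "y \<in> (\<lambda>S. D S / capacity G S) ` {S. S \<noteq> {} \<and> S \<subseteq> U}" for y
    proof -
      from that obtain S where S: "S \<noteq> {}" "S \<subseteq> U" "y = D S / capacity G S" by auto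
      then show ?thesis
        using D_le[of S] inflow_capacity[of S] capacity_pos[OF valid, of S]
        by (simp add: pos_divide_le_eq)
    qed
    have "v = D ?A / capacity G ?A" using D_A capacity_pos[OF valid A_ne] by simp
    then show "v \<in> (\<lambda>S. D S / capacity G S) ` {S. S \<noteq> {} \<and> S \<subseteq> U}" using A_ne by blast
  qed simp
  show sub: "S \<subseteq> ?A" if S: "S \<subseteq> U" "D S = v * capacity G S" for S
  proof (rule ccontr)
    assume "\<not> S \<subseteq> ?A"
    then obtain i where i: "i \<in> S" "flow_workload G x i \<noteq> v" using S by auto
    then have "flow_workload G x i < v" using v_ge[of i] S by auto
    then have "inflow G x i < v * service_rate G i"
      using \<mu>[of i] by (simp add: inflow_eq[OF valid] mult.commute)
    then have "(\<Sum>i\<in>S. inflow G x i) < (\<Sum>i\<in>S. v * service_rate G i)"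
      using i S inflow_le by (intro sum_strict_mono_ex1) auto
    then show False using D_le[OF S(1)] S(2) by (simp add: capacity_def sum_distrib_left)
  qed
  show "bottleneck G U D = ?A"
    unfolding bottleneck_def level using D_A sub by (intro Greatest_equality) auto
qed

text \<open>These are exactly the hypotheses of \<open>level_bottleneck\<close>. Removing the top
  level set of \<open>U\<close> leaves a lower level set, and the residual demands
  telescope.\<close>

lemma wf_stage_invariant:
  assumes x: "x \<in> flows G" and bal: "balanced_flow G x"
  shows "(\<forall>i j. i \<notin> fst (wf_stage G k) \<longrightarrow> j \<in> fst (wf_stage G k) \<longrightarrow>
      flow_workload G x j < flow_workload G x i) \<and>
    (\<forall>T\<subseteq>fst (wf_stage G k). snd (wf_stage G k) T =
      demand G (T \<union> - fst (wf_stage G k)) - demand G (- fst (wf_stage G k)))"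
proof (induction k)
  case 0
  show ?case by (simp add: demand_empty)
next
  case (Suc k)
  obtain U D where UD: "wf_stage G k = (U, D)" by force
  show ?case
  proof (cases "U = {}")
    \<comment> \<open>After termination \<open>bottleneck\<close> has no meaning, but the first
      claim is vacuous and the second, with \<open>T\<close> empty, reads 0 = 0 whatever set is
      returned.\<close>
    case True
    then show ?thesis by (simp add: UD Let_def)
  next
    case False
    let ?v = "Max (flow_workload G x ` U)"
    let ?A = "{i \<in> U. flow_workload G x i = ?v}"
    have low: "\<And>i j. i \<notin> U \<Longrightarrow> j \<in> U \<Longrightarrow> flow_workload G x j < flow_workload G x i"
      and D: "\<And>T. T \<subseteq> U \<Longrightarrow> D T = demand G (T \<union> - U) - demand G (- U)"
      using Suc by (auto simp: UD)
    have stage: "wf_stage G (Suc k) = (U - ?A, \<lambda>T. D (T \<union> ?A) - D ?A)"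
      by (simp add: UD Let_def level_bottleneck(2)[OF x bal False low D])
    have "flow_workload G x j < flow_workload G x i" if "i \<notin> U - ?A" "j \<in> U - ?A" for i j
    proof (cases "i \<in> U")
      case True
      have "flow_workload G x j \<le> ?v" using that by simp
      then show ?thesis using that True by (auto simp: less_le)
    qed (use that low in auto)
    moreover have "D (T \<union> ?A) - D ?A = demand G (T \<union> - (U - ?A)) - demand G (- (U - ?A))"
      if "T \<subseteq> U - ?A" for T
    proof -
      have eqs: "T \<union> ?A \<union> - U = T \<union> - (U - ?A)" "?A \<union> - U = - (U - ?A)" by auto
      have sub: "T \<union> ?A \<subseteq> U" "?A \<subseteq> U" using that by auto
      show ?thesis unfolding D[OF sub(1)] D[OF sub(2)] eqs by simp
    qed
    ultimately show ?thesis unfolding stage by simp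
  qed
qed

lemma
  assumes x: "x \<in> flows G" and bal: "balanced_flow G x" and ne: "fst (wf_stage G k) \<noteq> {}"
  shows wf_level_eq: "wf_level G k = Max (flow_workload G x ` fst (wf_stage G k))"
    and wf_block_eq: "wf_block G k =
      {i \<in> fst (wf_stage G k). flow_workload G x i = Max (flow_workload G x ` fst (wf_stage G k))}"
proof -
  obtain U D where UD: "wf_stage G k = (U, D)" by force
  have "U \<noteq> {}" and "\<And>i j. i \<notin> U \<Longrightarrow> j \<in> U \<Longrightarrow> flow_workload G x j < flow_workload G x i"
    and "\<And>T. T \<subseteq> U \<Longrightarrow> D T = demand G (T \<union> - U) - demand G (- U)"
    using wf_stage_invariant[OF x bal, of k] ne by (auto simp: UD)
  from level_bottleneck(1,2)[OF x bal this] show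
    "wf_level G k = Max (flow_workload G x ` fst (wf_stage G k))"
    "wf_block G k =
      {i \<in> fst (wf_stage G k). flow_workload G x i = Max (flow_workload G x ` fst (wf_stage G k))}"
    by (simp_all add: wf_level_def wf_block_def UD)
qed

section \<open>Termination of the recursion, its blocks and its levels\<close>

lemma wf_stage_Suc: "fst (wf_stage G (Suc k)) = fst (wf_stage G k) - wf_block G k"
  by (simp add: wf_block_def Let_def case_prod_unfold)

lemma wf_stage_antimono: "j \<le> k \<Longrightarrow> fst (wf_stage G k) \<subseteq> fst (wf_stage G j)"
  by (rule lift_Suc_antimono_le[of "\<lambda>k. fst (wf_stage G k)"]) (simp_all only: wf_stage_Suc Diff_subset)

lemma wf_block_nonempty:
  assumes "x \<in> flows G" "balanced_flow G x" "fst (wf_stage G k) \<noteq> {}"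
  shows "wf_block G k \<noteq> {}"
proof -
  have "Max (flow_workload G x ` fst (wf_stage G k)) \<in> flow_workload G x ` fst (wf_stage G k)"
    using assms(3) by (intro Max_in) auto
  then show ?thesis unfolding wf_block_eq[OF assms] by force
qed

text \<open>Every step removes at least one server while any remain, so the \<open>LEAST\<close> in
  \<open>wf_steps\<close> is attained.\<close>

lemma wf_stage_steps:
  assumes x: "x \<in> flows G" and bal: "balanced_flow G x"
  shows "fst (wf_stage G (wf_steps G)) = {}"
proof -
  have "\<exists>k. fst (wf_stage G k) = {}"
  proof (rule ccontr)
    assume "\<nexists>k. fst (wf_stage G k) = {}"
    then have ne: "fst (wf_stage G k) \<noteq> {}" for k by blast
    have "card (fst (wf_stage G k)) + k \<le> CARD('i)" for k
    proof (induction k)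
      case (Suc k)
      have "fst (wf_stage G (Suc k)) \<subset> fst (wf_stage G k)"
        using wf_block_nonempty[OF x bal ne, of k] wf_block_eq[OF x bal ne, of k]
        unfolding wf_stage_Suc by blast
      then have "card (fst (wf_stage G (Suc k))) < card (fst (wf_stage G k))"
        by (rule psubset_card_mono[rotated]) simp
      then show ?case using Suc by linarith
    qed simp
    from this[of "Suc CARD('i)"] show False by simp
  qed
  then show ?thesis unfolding wf_steps_def by (rule LeastI_ex)
qed

lemma wf_stage_nonempty: "k < wf_steps G \<Longrightarrow> fst (wf_stage G k) \<noteq> {}"
  unfolding wf_steps_def by (rule not_less_Least)

text \<open>Each server is removed in exactly one step, and the level of that step is the common
  workload of the servers removed.\<close>

lemma wf_workload_eq:
  assumes x: "x \<in> flows G" and bal: "balanced_flow G x"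
  shows "wf_workload G = flow_workload G x"
proof
  fix i
  have "\<exists>k<wf_steps G. i \<in> wf_block G k"
  proof (rule ccontr)
    assume *: "\<not> ?thesis"
    have "k \<le> wf_steps G \<Longrightarrow> i \<in> fst (wf_stage G k)" for k
    proof (induction k)
      case (Suc k)
      then show ?case using * unfolding wf_stage_Suc by auto
    qed simp
    then show False using wf_stage_steps[OF x bal] by blast
  qed
  then obtain k where k: "k < wf_steps G" "i \<in> wf_block G k" by blast
  have disjoint: False if "j < l" "l < wf_steps G" "i \<in> wf_block G j" "i \<in> wf_block G l" for j l
  proof -
    have "i \<in> fst (wf_stage G l)" using that wf_block_eq[OF x bal wf_stage_nonempty] by blast
    then have "i \<in> fst (wf_stage G (Suc j))" using that wf_stage_antimono[of "Suc j" l] by auto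
    then show False using that unfolding wf_stage_Suc by simp
  qed
  have "(THE k. k < wf_steps G \<and> i \<in> wf_block G k) = k"
    using k disjoint by (intro the_equality) (auto, metis linorder_neqE_nat)
  then show "wf_workload G i = flow_workload G x i"
    using k wf_level_eq[OF x bal wf_stage_nonempty[OF k(1)]]
      wf_block_eq[OF x bal wf_stage_nonempty[OF k(1)]]
    by (simp add: wf_workload_def)
qed

text \<open>A step removes all servers attaining the maximum, so the next maximum is taken over
  strictly smaller workloads.\<close>

lemma wf_level_decreasing:
  assumes x: "x \<in> flows G" and bal: "balanced_flow G x" and k: "Suc k < wf_steps G"
  shows "wf_level G (Suc k) < wf_level G k"
proof -
  let ?\<rho> = "flow_workload G x"
  have ne: "fst (wf_stage G k) \<noteq> {}" and ne': "fst (wf_stage G (Suc k)) \<noteq> {}"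
    using wf_stage_nonempty[of k] wf_stage_nonempty[OF k] k by simp_all
  have "Max (?\<rho> ` fst (wf_stage G (Suc k))) \<in> ?\<rho> ` fst (wf_stage G (Suc k))"
    using ne' by (intro Max_in) auto
  then obtain j where j: "j \<in> fst (wf_stage G (Suc k))" "wf_level G (Suc k) = ?\<rho> j"
    using wf_level_eq[OF x bal ne'] by auto
  then have "j \<in> fst (wf_stage G k)" "?\<rho> j \<noteq> Max (?\<rho> ` fst (wf_stage G k))"
    using wf_block_eq[OF x bal ne] unfolding wf_stage_Suc by auto
  then have "?\<rho> j < Max (?\<rho> ` fst (wf_stage G k))"
    by (simp add: less_le)
  then show ?thesis using j wf_level_eq[OF x bal ne] by simp
qed

text \<open>The instance of \<open>level_bottleneck\<close> with all servers remaining: the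
  complement is empty and has demand 0.\<close>

lemma first_wf_block:
  assumes x: "x \<in> flows G" and bal: "balanced_flow G x"
  shows "demand G (wf_block G 0) = wf_level G 0 * capacity G (wf_block G 0)"
    and "demand G S = wf_level G 0 * capacity G S \<Longrightarrow> S \<subseteq> wf_block G 0"
proof -
  let ?v = "Max (flow_workload G x ` UNIV)"
  have "demand G T = demand G (T \<union> - UNIV) - demand G (- UNIV)" for T by (simp add: demand_empty)
  note * = level_bottleneck[OF x bal UNIV_not_empty _ this, simplified]
  have eq: "wf_level G 0 = ?v" "wf_block G 0 = {i. flow_workload G x i = ?v}"
    using *(1,2) by (simp_all add: wf_level_def wf_block_def)
  show "demand G (wf_block G 0) = wf_level G 0 * capacity G (wf_block G 0)"
    unfolding eq by (rule *(3))
  show "demand G S = wf_level G 0 * capacity G S \<Longrightarrow> S \<subseteq> wf_block G 0"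
    unfolding eq by (rule *(4))
qed

text \<open>The first block certifies the lower bound: every flow must place its demand,
  \<open>wf_level G 0\<close> times its capacity, on its servers, so some server there reaches that
  level. The balanced flow attains it.\<close>

lemma min_peak_workload_eq:
  assumes x: "x \<in> flows G" and bal: "balanced_flow G x"
  shows "min_peak_workload G = wf_level G 0" and "wf_level G 0 = Max (range (flow_workload G x))"
proof -
  show eq: "wf_level G 0 = Max (range (flow_workload G x))"
    using wf_level_eq[OF x bal, of 0] by simp
  have "wf_level G 0 \<le> Max (range (flow_workload G y))" if y: "y \<in> flows G" for y
  proof -
    let ?S = "wf_block G 0" and ?m = "Max (range (flow_workload G y))"
    have "wf_level G 0 * capacity G ?S = demand G ?S" using first_wf_block(1)[OF x bal] by simp
    also have "\<dots> \<le> (\<Sum>i\<in>?S. inflow G y i)" by (rule demand_le_inflow[OF valid y])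
    also have "\<dots> \<le> ?m * capacity G ?S"
      unfolding capacity_def sum_distrib_left inflow_eq[OF valid]
      by (intro sum_mono) (simp add: service_rate_pos[OF valid] mult.commute)
    finally show ?thesis
      using capacity_pos[OF valid wf_block_nonempty[OF x bal, of 0]] by simp
  qed
  then show "min_peak_workload G = wf_level G 0"
    unfolding min_peak_workload_def using x eq by (intro Least_equality) auto
qed

lemma balanced_flow_iff_Min:
  assumes x: "x \<in> flows G"
  shows "balanced_flow G x \<longleftrightarrow> (\<forall>e\<in>hyperedges G. \<forall>i\<in>e. x e i > 0 \<longrightarrow>
    flow_workload G x i = Min (flow_workload G x ` e))"
proof -
  have "(\<forall>j\<in>e. flow_workload G x i \<le> flow_workload G x j) \<longleftrightarrow>
      flow_workload G x i = Min (flow_workload G x ` e)" if "i \<in> e" for e i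
  proof -
    have "Min (flow_workload G x ` e) \<le> flow_workload G x i" using that by simp
    moreover have "flow_workload G x i \<le> Min (flow_workload G x ` e) \<longleftrightarrow>
        (\<forall>j\<in>e. flow_workload G x i \<le> flow_workload G x j)"
      using that by (subst Min_ge_iff) auto
    ultimately show ?thesis by auto
  qed
  then show ?thesis unfolding balanced_flow_def by blast
qed

text \<open>The energy depends on a flow only through its workloads. A flow with the water-filling
  workloads thus has the energy of a minimizer, is itself one, and is therefore balanced.\<close>

lemma balanced_flow_iff_wf_workload:
  assumes x: "x \<in> flows G"
  shows "flow_workload G x = wf_workload G \<longleftrightarrow> balanced_flow G x"
proof
  assume eq: "flow_workload G x = wf_workload G"
  obtain z where z: "z \<in> flows G" "\<And>y. y \<in> flows G \<Longrightarrow> flow_energy G z \<le> flow_energy G y"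
    using ex_minimal_energy_flow[OF valid] by metis
  have "flow_workload G x = flow_workload G z"
    using eq wf_workload_eq[OF z(1) minimal_energy_imp_balanced_flow[OF valid z]] by simp
  then have "flow_energy G x = flow_energy G z"
    by (simp add: flow_energy_eq[OF valid] inflow_eq[OF valid])
  then show "balanced_flow G x" using minimal_energy_imp_balanced_flow[OF valid x] z(2) by simp
qed (simp add: wf_workload_eq[OF x])

lemma total_inflow:
  assumes "x \<in> flows G"
  shows "(\<Sum>i\<in>UNIV. inflow G x i) = demand G UNIV"
  using assms sum_inflow[of "\<lambda>_. 1" G x UNIV] by (simp add: demand_def flows_def)

end

section \<open>Workload variance for equal service rates\<close>

lemma workload_var_eq:
  "workload_var \<rho> = (\<Sum>i\<in>UNIV. (\<rho> i)\<^sup>2) / real CARD('i) - (workload_mean \<rho>)\<^sup>2"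
  for \<rho> :: "'i::finite \<Rightarrow> real"
proof -
  have "(\<Sum>i\<in>UNIV. (\<rho> i - workload_mean \<rho>)\<^sup>2) =
      (\<Sum>i\<in>UNIV. (\<rho> i)\<^sup>2) - 2 * workload_mean \<rho> * (\<Sum>i\<in>UNIV. \<rho> i) +
      real CARD('i) * (workload_mean \<rho>)\<^sup>2"
  proof -
    have "(\<rho> i - workload_mean \<rho>)\<^sup>2 =
        (\<rho> i)\<^sup>2 - 2 * workload_mean \<rho> * \<rho> i + (workload_mean \<rho>)\<^sup>2" for i
      by (simp add: power2_diff)
    then show ?thesis by (simp add: sum.distrib sum_subtractf flip: sum_distrib_left)
  qed
  then show ?thesis
    by (simp add: workload_var_def workload_mean_def field_simps power2_eq_square)
qed

text \<open>Equal service rates give all flows the same mean workload, since the total inflow is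
  fixed. The variance is then an increasing affine function of the energy.\<close>

lemma workload_var_flow_workload:
  fixes G :: "'i::finite dispatch_system"
  assumes valid: "valid_system G" and \<mu>: "\<And>i. service_rate G i = \<mu>" and y: "y \<in> flows G"
  shows "workload_var (flow_workload G y) =
    flow_energy G y / (\<mu> * real CARD('i)) - (demand G UNIV / (\<mu> * real CARD('i)))\<^sup>2"
proof -
  have "(\<Sum>i\<in>UNIV. (flow_workload G y i)\<^sup>2) = flow_energy G y / \<mu>"
    by (simp add: flow_energy_def flow_workload_def \<mu> sum_divide_distrib power2_eq_square)
  moreover have "(\<Sum>i\<in>UNIV. flow_workload G y i) = demand G UNIV / \<mu>"
    by (simp add: flow_workload_def \<mu> total_inflow[OF valid y] flip: sum_divide_distrib)
  ultimately show ?thesis by (simp add: workload_var_eq workload_mean_def)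
qed

section \<open>The three claims, derived from one energy-minimal flow\<close>

theorem proposition2:
  fixes G :: "'i::finite dispatch_system" and \<mu> :: real
  assumes "valid_system G"
    and "\<forall>i. service_rate G i = \<mu>"
    and "min_peak_workload G < 1"
  shows
    "(1 > wf_level G 0 \<and>
      (\<forall>k. Suc k < wf_steps G \<longrightarrow> wf_level G k > wf_level G (Suc k)) \<and>
      wf_level G 0 = min_peak_workload G \<and>
      demand G (wf_block G 0) = min_peak_workload G * capacity G (wf_block G 0) \<and>
      wf_block G 0 = \<Union>{S. demand G S = min_peak_workload G * capacity G S} \<and>
      (\<exists>\<eta>\<in>stable_policies G. state_independent G \<eta> \<and> workload G \<eta> = wf_workload G))
     \<and>
     ((\<forall>\<rho>. is_arg_min workload_var (\<lambda>\<rho>. \<rho> \<in> attainable_region G) \<rho> \<longleftrightarrow> \<rho> = wf_workload G) \<and>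
      (\<forall>\<rho>. is_arg_min workload_sd (\<lambda>\<rho>. \<rho> \<in> attainable_region G) \<rho> \<longleftrightarrow> \<rho> = wf_workload G) \<and>
      (\<forall>\<eta>\<in>stable_policies G. workload_sd (wf_workload G) \<le> workload_sd (workload G \<eta>)) \<and>
      (\<exists>\<eta>\<in>stable_policies G. state_independent G \<eta> \<and> balance_optimal G \<eta> \<and>
         workload_sd (workload G \<eta>) = workload_sd (wf_workload G)))
     \<and>
     (\<forall>x\<in>flows G.
        ((\<forall>i. flow_workload G x i = wf_workload G i) \<longleftrightarrow>
           (\<forall>e\<in>hyperedges G. \<forall>i\<in>e. x e i > 0 \<longrightarrow>
              flow_workload G x i = Min (flow_workload G x ` e))) \<and>
        ((\<forall>i. flow_workload G x i = wf_workload G i) \<longrightarrow>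
           (\<exists>\<eta>. induced_policy G x \<eta>) \<and>
           (\<forall>\<eta>. induced_policy G x \<eta> \<longrightarrow>
              \<eta> \<in> stable_policies G \<and> balance_optimal G \<eta> \<and>
              workload_sd (workload G \<eta>) = workload_sd (wf_workload G))))"
proof -
  note valid = assms(1)
  have \<mu>: "service_rate G i = \<mu>" for i using assms(2) by simp
  have \<mu>_pos: "0 < \<mu>" using service_rate_pos[OF valid] \<mu> by metis
  obtain z where z: "z \<in> flows G" and z_min: "\<And>y. y \<in> flows G \<Longrightarrow> flow_energy G z \<le> flow_energy G y"
    using ex_minimal_energy_flow[OF valid] by metis
  have z_bal: "balanced_flow G z" by (rule minimal_energy_imp_balanced_flow[OF valid z z_min])
  have wf_z: "wf_workload G = flow_workload G z" by (rule wf_workload_eq[OF valid z z_bal])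
  note peak = min_peak_workload_eq[OF valid z z_bal]
  \<comment> \<open>The peak of the reference flow \<open>z\<close> is the minimum peak, so all its
    workloads are below 1; this makes every policy induced by a flow with these workloads
    stable.\<close>
  have wf_less: "wf_workload G i < 1" for i
  proof -
    have "flow_workload G z i \<le> Max (range (flow_workload G z))" by simp
    then show ?thesis using peak assms(3) wf_z by simp
  qed
  have induced: "\<eta> \<in> stable_policies G" "workload G \<eta> = wf_workload G"
    if "x \<in> flows G" "flow_workload G x = wf_workload G" "induced_policy G x \<eta>" for x \<eta>
    using induced_policy_stable[OF valid that(1,3)] wf_less that(2) by simp_all
  obtain \<eta> where \<eta>: "induced_policy G z \<eta>" using ex_induced_policy[OF valid z] by blast
  have \<eta>_stable: "\<eta> \<in> stable_policies G" and \<eta>_wf: "workload G \<eta> = wf_workload G"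
    using induced[OF z wf_z[symmetric] \<eta>] by simp_all
  have \<eta>_indep: "state_independent G \<eta>" using \<eta> by (simp add: induced_policy_def)
  have in_region: "wf_workload G \<in> attainable_region G"
    unfolding attainable_region_def using \<eta>_stable \<eta>_wf by (metis imageI)
  have region_flow: "\<exists>y\<in>flows G. \<rho> = flow_workload G y" if "\<rho> \<in> attainable_region G" for \<rho>
    using that stable_workload_eq_flow_workload[OF valid] unfolding attainable_region_def
    by (metis imageE)
  have var_le_iff: "workload_var (flow_workload G x) \<le> workload_var (flow_workload G y) \<longleftrightarrow>
      flow_energy G x \<le> flow_energy G y" if "x \<in> flows G" "y \<in> flows G" for x y
  proof -
    have "0 < \<mu> * real CARD('i)" using \<mu>_pos by simp
    then have "a / (\<mu> * real CARD('i)) \<le> b / (\<mu> * real CARD('i)) \<longleftrightarrow> a \<le> b" for a b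
      by (smt (verit) divide_le_cancel)
    then show ?thesis by (simp add: workload_var_flow_workload[OF valid \<mu>] that)
  qed
  have var_le: "workload_var (wf_workload G) \<le> workload_var \<rho>" if "\<rho> \<in> attainable_region G" for \<rho>
    using region_flow[OF that] var_le_iff[OF z] z_min wf_z by auto
  have var_unique: "\<rho> = wf_workload G"
    if "\<rho> \<in> attainable_region G" "workload_var \<rho> \<le> workload_var (wf_workload G)" for \<rho>
    using region_flow[OF that(1)] that(2) var_le_iff[OF _ z] wf_z
      flow_workload_eq_of_energy_le[OF valid z z_bal] by auto
  have var_min: "is_arg_min workload_var (\<lambda>\<rho>. \<rho> \<in> attainable_region G) \<rho> \<longleftrightarrow> \<rho> = wf_workload G" for \<rho>
    unfolding is_arg_min_def using in_region var_le var_unique by (meson not_le)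
  \<comment> \<open>The square root is strictly increasing, so variance and standard deviation have
    the same minimizers.\<close>
  have sd_min: "is_arg_min workload_sd (\<lambda>\<rho>. \<rho> \<in> attainable_region G) \<rho> \<longleftrightarrow> \<rho> = wf_workload G" for \<rho>
    using var_min[of \<rho>] by (simp add: is_arg_min_def workload_sd_def)
  have sd_le: "workload_sd (wf_workload G) \<le> workload_sd (workload G \<eta>')"
    if "\<eta>' \<in> stable_policies G" for \<eta>'
    using var_le that by (simp add: workload_sd_def attainable_region_def)
  have optimal: "balance_optimal G \<eta>'"
    if "\<eta>' \<in> stable_policies G" "workload G \<eta>' = wf_workload G" for \<eta>'
    unfolding balance_optimal_def is_arg_min_def using that sd_le by (auto simp: not_less)
  have block: "wf_block G 0 = \<Union>{S. demand G S = min_peak_workload G * capacity G S}"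
    using first_wf_block[OF valid z z_bal] unfolding peak(1) by blast
  have flow_iff: "(\<forall>i. flow_workload G x i = wf_workload G i) \<longleftrightarrow>
      (\<forall>e\<in>hyperedges G. \<forall>i\<in>e. x e i > 0 \<longrightarrow>
        flow_workload G x i = Min (flow_workload G x ` e))" if "x \<in> flows G" for x
    using balanced_flow_iff_wf_workload[OF valid that] balanced_flow_iff_Min[OF valid that]
    by (simp add: fun_eq_iff)
  have attaining: "(\<exists>\<eta>. induced_policy G x \<eta>) \<and> (\<forall>\<eta>. induced_policy G x \<eta> \<longrightarrow>
      \<eta> \<in> stable_policies G \<and> balance_optimal G \<eta> \<and>
      workload_sd (workload G \<eta>) = workload_sd (wf_workload G))"
    if "x \<in> flows G" "\<forall>i. flow_workload G x i = wf_workload G i" for x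
    using ex_induced_policy[OF valid that(1)] induced[OF that(1)] optimal that(2)
    by (simp add: fun_eq_iff[of "flow_workload G x"])
  show ?thesis
  proof (intro conjI)
    show "1 > wf_level G 0" using assms(3) peak by simp
    show "\<forall>k. Suc k < wf_steps G \<longrightarrow> wf_level G k > wf_level G (Suc k)"
      using wf_level_decreasing[OF valid z z_bal] by blast
    show "wf_level G 0 = min_peak_workload G" using peak by simp
    show "demand G (wf_block G 0) = min_peak_workload G * capacity G (wf_block G 0)"
      using first_wf_block(1)[OF valid z z_bal] peak by simp
    show "\<exists>\<eta>\<in>stable_policies G. state_independent G \<eta> \<and> workload G \<eta> = wf_workload G"
      using \<eta>_stable \<eta>_indep \<eta>_wf by blast
    show "\<exists>\<eta>\<in>stable_policies G. state_independent G \<eta> \<and> balance_optimal G \<eta> \<and>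
        workload_sd (workload G \<eta>) = workload_sd (wf_workload G)"
      using \<eta>_stable \<eta>_indep \<eta>_wf optimal by metis
  qed (use block var_min sd_min sd_le flow_iff attaining in blast)+
qed

end
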